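(* If $P$ is a normal finitely recursive program, then there exists a complete $\mathsf{CounterSupp}$ function for $P$ such that for every atom $A$, the set $\mathsf{CounterSupp}(A)$ is recursively enumerable.
   Context: A normal program is a finite set of rules $A\leftarrow L_1,\dots,L_n$ ($A$ an atom, $L_i$ atoms or negated atoms $\mathtt{not}\,B$), possibly with function symbols; $\mathsf{Ground}(P)$ is its ground instantiation. The dependency graph has an edge from $A$ to each atom occurring in the body of a ground rule with head $A$; $A$ depends on $B$ if there is a directed path from $A$ to $B$ (each atom depends on itself); $P$ is finitely recursive iff each ground atom depends on finitely many ground atoms. A support for a ground atom $A$ is a set of negative literals that is the final goal of an SLD derivation from $A$ using $\mathsf{Ground}(P)$ in which only positive literals are resolved, ending when no positive literal is left. A ground counter-support for $A$ is a set $K$ of ground atoms such that (1) every support $S$ of $A$ contains some $\mathtt{not}\,B$ with $B\in K$, and (2) for each $B\in K$ some support of $A$ contains $\mathtt{not}\,B$. A (generalized) counter-support for an atom $A$ is a pair $\langle K,\theta\rangle$, $K$ a set of atoms and $\theta$ a substitution, such that for every grounding substitution $\sigma$, $K\sigma$ is a ground counter-support for $A\theta\sigma$. A $\mathsf{CounterSupp}$ function maps each (possibly nonground) atom $A$ to a set of finite generalized counter-supports for $A$; it is complete iff for every atom $A$, every ground instance $A\gamma$ and every ground counter-support $K$ of $A\gamma$, there exist $\langle K',\theta\rangle\in\mathsf{CounterSupp}(A)$ and a substitution $\sigma$ with $A\theta\sigma=A\gamma$ and $K'\sigma=K$. *)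

theory Defs
  imports Main "HOL-Library.Nat_Bijection"
begin

text \<open>Variables, function symbols and predicate symbols are natural numbers;
  arities are given by the length of the argument list.\<close>

datatype trm = Var nat | Fn nat "trm list"
datatype atm = Atm nat "trm list"
datatype lit = Pos atm | Neg atm

type_synonym rule = "atm \<times> lit list"
type_synonym subst = "nat \<Rightarrow> trm"

fun subst_trm :: "subst \<Rightarrow> trm \<Rightarrow> trm" where
  "subst_trm \<sigma> (Var x) = \<sigma> x"
| "subst_trm \<sigma> (Fn f ts) = Fn f (map (subst_trm \<sigma>) ts)"

fun subst_atm :: "subst \<Rightarrow> atm \<Rightarrow> atm" where
  "subst_atm \<sigma> (Atm p ts) = Atm p (map (subst_trm \<sigma>) ts)"

fun subst_lit :: "subst \<Rightarrow> lit \<Rightarrow> lit" where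
  "subst_lit \<sigma> (Pos a) = Pos (subst_atm \<sigma> a)"
| "subst_lit \<sigma> (Neg a) = Neg (subst_atm \<sigma> a)"

fun lit_atm :: "lit \<Rightarrow> atm" where
  "lit_atm (Pos a) = a"
| "lit_atm (Neg a) = a"

fun vars_trm :: "trm \<Rightarrow> nat set" where
  "vars_trm (Var x) = {x}"
| "vars_trm (Fn f ts) = \<Union> (set (map vars_trm ts))"

fun syms_trm :: "trm \<Rightarrow> (nat \<times> nat) set" where
  "syms_trm (Var x) = {}"
| "syms_trm (Fn f ts) = insert (f, length ts) (\<Union> (set (map syms_trm ts)))"

fun syms_atm :: "atm \<Rightarrow> (nat \<times> nat) set" where
  "syms_atm (Atm p ts) = \<Union> (set (map syms_trm ts))"

definition syms_rule :: "rule \<Rightarrow> (nat \<times> nat) set" where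
  "syms_rule r = syms_atm (fst r) \<union> \<Union> (set (map (syms_atm \<circ> lit_atm) (snd r)))"

definition syms_prog :: "rule set \<Rightarrow> (nat \<times> nat) set" where
  "syms_prog P = \<Union> (syms_rule ` P)"

text \<open>The language of \<open>P\<close>: its function symbols, plus a default constant \<open>0\<close> if
  \<open>P\<close> contains no constant (standard Herbrand-universe convention).\<close>

definition lang :: "rule set \<Rightarrow> (nat \<times> nat) set" where
  "lang P = syms_prog P \<union> (if \<exists>c. (c, 0) \<in> syms_prog P then {} else {(0, 0)})"

definition in_hu :: "rule set \<Rightarrow> trm \<Rightarrow> bool" where
  "in_hu P t \<longleftrightarrow> vars_trm t = {} \<and> syms_trm t \<subseteq> lang P"

definition in_hb :: "rule set \<Rightarrow> atm \<Rightarrow> bool" where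
  "in_hb P a \<longleftrightarrow> (case a of Atm p ts \<Rightarrow> (\<forall>t\<in>set ts. in_hu P t))"

definition grounding :: "rule set \<Rightarrow> subst \<Rightarrow> bool" where
  "grounding P \<sigma> \<longleftrightarrow> (\<forall>x. in_hu P (\<sigma> x))"

definition Ground :: "rule set \<Rightarrow> rule set" where
  "Ground P = {(subst_atm \<sigma> h, map (subst_lit \<sigma>) b) | \<sigma> h b. (h, b) \<in> P \<and> grounding P \<sigma>}"

definition dep_edge :: "rule set \<Rightarrow> atm \<Rightarrow> atm \<Rightarrow> bool" where
  "dep_edge P A B \<longleftrightarrow> (\<exists>b. (A, b) \<in> Ground P \<and> B \<in> lit_atm ` set b)"

definition depends :: "rule set \<Rightarrow> atm \<Rightarrow> atm \<Rightarrow> bool" where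
  "depends P A B \<longleftrightarrow> (dep_edge P)\<^sup>*\<^sup>* A B"

definition finitely_recursive :: "rule set \<Rightarrow> bool" where
  "finitely_recursive P \<longleftrightarrow> (\<forall>A. in_hb P A \<longrightarrow> finite {B. depends P A B})"

definition sld_step :: "rule set \<Rightarrow> lit list \<Rightarrow> lit list \<Rightarrow> bool" where
  "sld_step P G G' \<longleftrightarrow>
     (\<exists>xs B ys body. G = xs @ Pos B # ys \<and> (B, body) \<in> Ground P \<and> G' = xs @ body @ ys)"

text \<open>\<open>support P A S\<close>: the set of negative literals \<open>{not B | B \<in> S}\<close> is a support of \<open>A\<close>,
  i.e. the final goal of an SLD derivation from \<open>A\<close> resolving only positive literals
  and ending when no positive literal is left.\<close>

definition support :: "rule set \<Rightarrow> atm \<Rightarrow> atm set \<Rightarrow> bool" where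
  "support P A S \<longleftrightarrow>
     (\<exists>G. (sld_step P)\<^sup>*\<^sup>* [Pos A] G \<and> (\<forall>L\<in>set G. \<exists>B. L = Neg B) \<and> S = {B. Neg B \<in> set G})"

definition ground_counter_support :: "rule set \<Rightarrow> atm \<Rightarrow> atm set \<Rightarrow> bool" where
  "ground_counter_support P A K \<longleftrightarrow>
     (\<forall>B\<in>K. in_hb P B) \<and>
     (\<forall>S. support P A S \<longrightarrow> (\<exists>B\<in>K. B \<in> S)) \<and>
     (\<forall>B\<in>K. \<exists>S. support P A S \<and> B \<in> S)"

definition gen_counter_support :: "rule set \<Rightarrow> atm \<Rightarrow> atm set \<times> subst \<Rightarrow> bool" where
  "gen_counter_support P A Kt \<longleftrightarrow>
     (\<forall>\<sigma>. grounding P \<sigma> \<longrightarrow>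
        ground_counter_support P (subst_atm \<sigma> (subst_atm (snd Kt) A)) (subst_atm \<sigma> ` fst Kt))"

definition is_CounterSupp :: "rule set \<Rightarrow> (atm \<Rightarrow> (atm set \<times> subst) set) \<Rightarrow> bool" where
  "is_CounterSupp P CS \<longleftrightarrow>
     (\<forall>A. \<forall>Kt\<in>CS A. finite (fst Kt) \<and> gen_counter_support P A Kt)"

definition complete_CounterSupp :: "rule set \<Rightarrow> (atm \<Rightarrow> (atm set \<times> subst) set) \<Rightarrow> bool" where
  "complete_CounterSupp P CS \<longleftrightarrow>
     (\<forall>A \<gamma> K. grounding P \<gamma> \<longrightarrow> ground_counter_support P (subst_atm \<gamma> A) K \<longrightarrow>
        (\<exists>Kt\<in>CS A. \<exists>\<sigma>. subst_atm \<sigma> (subst_atm (snd Kt) A) = subst_atm \<gamma> A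
                        \<and> subst_atm \<sigma> ` fst Kt = K))"

datatype recf = Zr | Sc | Id nat | Cn recf "recf list" | Pr recf recf | Mn recf

inductive eval :: "recf \<Rightarrow> nat list \<Rightarrow> nat \<Rightarrow> bool" where
  "eval Zr xs 0"
| "eval Sc (x # xs) (Suc x)"
| "i < length xs \<Longrightarrow> eval (Id i) xs (xs ! i)"
| "list_all2 (\<lambda>g y. eval g xs y) gs ys \<Longrightarrow> eval f ys z \<Longrightarrow> eval (Cn f gs) xs z"
| "eval f xs y \<Longrightarrow> eval (Pr f g) (0 # xs) y"
| "eval (Pr f g) (k # xs) y \<Longrightarrow> eval g (k # y # xs) z \<Longrightarrow> eval (Pr f g) (Suc k # xs) z"
| "eval f (y # xs) 0 \<Longrightarrow> (\<forall>i<y. \<exists>v. eval f (i # xs) v \<and> v \<noteq> 0) \<Longrightarrow> eval (Mn f) xs y"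

definition re_nat :: "nat set \<Rightarrow> bool" where
  "re_nat C \<longleftrightarrow> (\<exists>f. C = {x. \<exists>y. eval f [x] y})"

fun enc_trm :: "trm \<Rightarrow> nat" where
  "enc_trm (Var x) = 2 * x"
| "enc_trm (Fn f ts) = 2 * prod_encode (f, list_encode (map enc_trm ts)) + 1"

fun enc_atm :: "atm \<Rightarrow> nat" where
  "enc_atm (Atm p ts) = prod_encode (p, list_encode (map enc_trm ts))"

definition enc_cs :: "atm list \<Rightarrow> (nat \<times> trm) list \<Rightarrow> nat" where
  "enc_cs ks bs = prod_encode (list_encode (map enc_atm ks),
                               list_encode (map (\<lambda>(x, t). prod_encode (x, enc_trm t)) bs))"

definition subst_of :: "(nat \<times> trm) list \<Rightarrow> subst" where
  "subst_of bs x = (case map_of bs x of Some t \<Rightarrow> t | None \<Rightarrow> Var x)"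

definition re_cs_set :: "(atm set \<times> subst) set \<Rightarrow> bool" where
  "re_cs_set X \<longleftrightarrow>
     (\<exists>C. re_nat C \<and> X = {(set ks, subst_of bs) | ks bs. enc_cs ks bs \<in> C})"

end

theory Submission
  imports Defs
begin

text \<open>For a ground atom \<open>A\<close>, the claim that \<open>K\<close> is a ground counter-support of \<open>A\<close> has a finite
  certificate. That each \<open>B \<in> K\<close> occurs in some support is witnessed by a derivation. That every
  support meets \<open>K\<close> is witnessed by a finite set \<open>N\<close> containing \<open>A\<close> such that each ground rule with
  head in \<open>N\<close> has a negative body atom in \<open>K\<close> or a positive one in \<open>N\<close>; by finite recursiveness such
  an \<open>N\<close> exists among the atoms on which \<open>A\<close> depends. If the Herbrand universe is infinite, finite
  recursiveness forces every variable of a rule to occur in its head, so the ground rules with a given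
  head can be found by bounded search and the certificates can be checked. The counter-supports of \<open>A\<close>
  are then enumerated as the pairs \<open>(K, \<theta>)\<close> with \<open>A\<theta>\<close> ground and \<open>K\<close> a ground counter-support of
  \<open>A\<theta>\<close>. If the Herbrand universe is finite, there are only finitely many such pairs.\<close>

text \<open>Recursive enumerability here means a concrete \<open>recf\<close> program, so
  certificate checks are assembled from closure properties. The inductive notions (coded lists,
  Herbrand terms, supports) all enter through \<open>re_derivable\<close>: what is generated by an
  r.e. relation with finite premise sets is r.e. The obstacle is the universal clause of a
  counter-support, since an atom may have infinitely many derivations. The set \<open>N\<close> that
  replaces it is in effect an unfounded set relative to \<open>K\<close>. Checking \<open>N\<close>
  still quantifies over all rule instances with a given head. A body variable missing from the head
  would leave this search unbounded; otherwise the code of the head bounds the matching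
  substitution. The same condition lets \<open>Ground P\<close> be replaced by
  \<open>instances P\<close>, where no groundness test occurs. The case distinction on the size of
  the Herbrand universe is not effective, but only the existence of an enumerator for each atom is
  claimed. Taking the instance of \<open>A\<close> ground makes every later substitution act as the
  identity, so completeness involves no unification.\<close>

section \<open>Recursive functions\<close>

text \<open>The equivalence expresses termination and uniqueness of the value at once, so
  \<open>eval\<close> is never separately shown to be single-valued.\<close>

definition computes :: "recf \<Rightarrow> nat \<Rightarrow> (nat list \<Rightarrow> nat) \<Rightarrow> bool" where
  "computes f n F \<longleftrightarrow> (\<forall>xs y. length xs = n \<longrightarrow> (eval f xs y \<longleftrightarrow> y = F xs))"

definition recursive :: "nat \<Rightarrow> (nat list \<Rightarrow> nat) \<Rightarrow> bool" where
  "recursive n F \<longleftrightarrow> (\<exists>f. computes f n F)"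

lemma recursive_cong:
  assumes "recursive n F" and "\<And>xs. length xs = n \<Longrightarrow> F xs = G xs"
  shows "recursive n G"
  using assms unfolding recursive_def computes_def by metis

lemma recursive_nth: "i < n \<Longrightarrow> recursive n (\<lambda>xs. xs ! i)"
  unfolding recursive_def computes_def
  by (intro exI[of _ "Id i"]) (auto intro: eval.intros elim: eval.cases)

lemma recursive_zero: "recursive n (\<lambda>xs. 0)"
  unfolding recursive_def computes_def
  by (intro exI[of _ Zr]) (auto intro: eval.intros elim: eval.cases)

lemma recursive_Suc_0: "recursive 1 (\<lambda>xs. Suc (xs ! 0))"
  unfolding recursive_def computes_def
proof (intro exI[of _ Sc] allI impI)
  fix xs :: "nat list" and y
  assume "length xs = 1"
  then obtain x where "xs = [x]" by (auto simp: length_Suc_conv)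
  then show "eval Sc xs y \<longleftrightarrow> y = Suc (xs ! 0)"
    by (auto intro: eval.intros elim: eval.cases)
qed

lemma recursive_compose:
  assumes "recursive k F" and "length Gs = k" and "\<And>G. G \<in> set Gs \<Longrightarrow> recursive n G"
  shows "recursive n (\<lambda>xs. F (map (\<lambda>G. G xs) Gs))"
proof -
  obtain f where f: "computes f k F" using assms(1) unfolding recursive_def by blast
  have "\<exists>gs. list_all2 (\<lambda>g G. computes g n G) gs Gs"
    using assms(3)
  proof (induction Gs)
    case (Cons G Gs)
    obtain g where "computes g n G"
      using Cons.prems[of G] by (auto simp: recursive_def)
    moreover obtain gs where "list_all2 (\<lambda>g G. computes g n G) gs Gs"
      using Cons by auto
    ultimately show ?case by (intro exI[of _ "g # gs"]) simp
  qed simp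
  then obtain gs where gs: "list_all2 (\<lambda>g G. computes g n G) gs Gs" by blast
  have args: "list_all2 (\<lambda>g y. eval g xs y) gs ys \<longleftrightarrow> ys = map (\<lambda>G. G xs) Gs"
    if "length xs = n" for xs ys
    using gs that
  proof (induction gs Gs arbitrary: ys rule: list_all2_induct)
    case (Cons g gs G Gs)
    then show ?case by (cases ys) (auto simp: computes_def)
  qed simp
  have "computes (Cn f gs) n (\<lambda>xs. F (map (\<lambda>G. G xs) Gs))"
    unfolding computes_def
  proof (intro allI impI)
    fix xs :: "nat list" and z
    assume n: "length xs = n"
    have "eval (Cn f gs) xs z \<longleftrightarrow> (\<exists>ys. list_all2 (\<lambda>g y. eval g xs y) gs ys \<and> eval f ys z)"
      by (subst eval.simps) auto
    also have "\<dots> \<longleftrightarrow> z = F (map (\<lambda>G. G xs) Gs)"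
      using args[OF n] f assms(2) by (simp add: computes_def)
    finally show "eval (Cn f gs) xs z \<longleftrightarrow> z = F (map (\<lambda>G. G xs) Gs)" .
  qed
  then show ?thesis unfolding recursive_def by blast
qed

lemma recursive_compose1:
  assumes "recursive 1 (\<lambda>xs. H (xs ! 0))" and "recursive n F"
  shows "recursive n (\<lambda>xs. H (F xs))"
  using recursive_compose[OF assms(1), of "[F]" n] assms(2) by simp

lemma recursive_compose2:
  assumes "recursive 2 (\<lambda>xs. H (xs ! 0) (xs ! 1))" and "recursive n F" and "recursive n G"
  shows "recursive n (\<lambda>xs. H (F xs) (G xs))"
  using recursive_compose[OF assms(1), of "[F, G]" n] assms(2,3) by auto

lemma recursive_rec_nat:
  assumes "recursive n F" and "recursive (Suc (Suc n)) G"
  shows "recursive (Suc n) (\<lambda>xs. rec_nat (F (tl xs)) (\<lambda>k y. G (k # y # tl xs)) (hd xs))"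
proof -
  obtain f g where f: "computes f n F" and g: "computes g (Suc (Suc n)) G"
    using assms unfolding recursive_def by blast
  have base: "eval (Pr f g) (0 # xs) y \<longleftrightarrow> eval f xs y" for xs y
    by (subst eval.simps) auto
  have step: "eval (Pr f g) (Suc k # xs) z \<longleftrightarrow>
      (\<exists>y. eval (Pr f g) (k # xs) y \<and> eval g (k # y # xs) z)" for k xs z
    by (subst eval.simps) auto
  have "eval (Pr f g) (k # xs) y \<longleftrightarrow> y = rec_nat (F xs) (\<lambda>k y. G (k # y # xs)) k"
    if "length xs = n" for k xs y
  proof (induction k arbitrary: y)
    case 0
    then show ?case using f that by (simp add: base computes_def)
  next
    case (Suc k)
    then show ?case using g that by (simp add: step computes_def)
  qed
  then have "computes (Pr f g) (Suc n)
      (\<lambda>xs. rec_nat (F (tl xs)) (\<lambda>k y. G (k # y # tl xs)) (hd xs))"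
    unfolding computes_def by (auto simp: length_Suc_conv)
  then show ?thesis unfolding recursive_def by blast
qed

lemma eval_Mn_iff:
  assumes "computes f (Suc n) F" and "length xs = n"
  shows "eval (Mn f) xs y \<longleftrightarrow> F (y # xs) = 0 \<and> (\<forall>i<y. F (i # xs) \<noteq> 0)"
  using assms by (subst eval.simps) (auto simp: computes_def)

text \<open>\<open>Mn\<close> stops at the first zero if all earlier values are defined and nonzero.
  They are defined because \<open>F\<close> is total, and the second hypothesis provides a
  zero.\<close>

lemma recursive_Least:
  assumes "recursive (Suc n) F" and "\<And>xs. length xs = n \<Longrightarrow> \<exists>y. F (y # xs) = 0"
  shows "recursive n (\<lambda>xs. LEAST y. F (y # xs) = 0)"
proof -
  obtain f where f: "computes f (Suc n) F" using assms(1) unfolding recursive_def by blast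
  have "F (y # xs) = 0 \<and> (\<forall>i<y. F (i # xs) \<noteq> 0) \<longleftrightarrow> y = (LEAST y. F (y # xs) = 0)"
    if "length xs = n" for xs y
    using assms(2)[OF that]
    by (metis (mono_tags, lifting) LeastI not_less_Least linorder_neqE_nat)
  then have "computes (Mn f) n (\<lambda>xs. LEAST y. F (y # xs) = 0)"
    unfolding computes_def using eval_Mn_iff[OF f] by simp
  then show ?thesis unfolding recursive_def by blast
qed

lemma length2_conv: "length xs = 2 \<longleftrightarrow> (\<exists>x y. xs = [x, y])"
  by (auto simp: numeral_2_eq_2 length_Suc_conv)

text \<open>\<open>H\<close> is a function already at hand, so an application only verifies its two
  recursion equations. Unary functions are given a dummy second argument.\<close>

lemma recursive_rec2:
  assumes "recursive 1 (\<lambda>xs. F (xs ! 0))" and "recursive 3 (\<lambda>xs. G (xs ! 0) (xs ! 1) (xs ! 2))"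
    and "\<And>x. H 0 x = F x" and "\<And>k x. H (Suc k) x = G k (H k x) x"
  shows "recursive 2 (\<lambda>xs. H (xs ! 0) (xs ! 1))"
proof -
  have H: "rec_nat (F x) (\<lambda>k y. G k y x) k = H k x" for k x
    by (induction k) (simp_all add: assms(3,4))
  have "recursive (Suc 1) (\<lambda>xs. rec_nat (F (tl xs ! 0))
      (\<lambda>k y. G ((k # y # tl xs) ! 0) ((k # y # tl xs) ! 1) ((k # y # tl xs) ! 2)) (hd xs))"
    by (rule recursive_rec_nat) (use assms(1,2) in \<open>simp_all add: numeral_3_eq_3\<close>)
  then show ?thesis
    unfolding Suc_1 by (rule recursive_cong) (auto simp: length2_conv H)
qed

section \<open>Arithmetic and the Cantor pairing\<close>

lemma recursive_Suc: "recursive n F \<Longrightarrow> recursive n (\<lambda>xs. Suc (F xs))"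
  by (rule recursive_compose1[OF recursive_Suc_0])

lemma recursive_const: "recursive n (\<lambda>xs. c)"
  by (induction c) (auto intro: recursive_zero recursive_Suc)

lemma recursive_add:
  assumes "recursive n F" "recursive n G"
  shows "recursive n (\<lambda>xs. F xs + G xs)"
proof (rule recursive_compose2[of "(+)", OF _ assms])
  show "recursive 2 (\<lambda>xs. xs ! 0 + xs ! 1)"
    by (rule recursive_rec2[where F = "\<lambda>x. x" and G = "\<lambda>k y x. Suc y"])
      (auto intro!: recursive_Suc recursive_nth)
qed

lemma recursive_mult:
  assumes "recursive n F" "recursive n G"
  shows "recursive n (\<lambda>xs. F xs * G xs)"
proof (rule recursive_compose2[of "(*)", OF _ assms])
  show "recursive 2 (\<lambda>xs. xs ! 0 * xs ! 1)"
    by (rule recursive_rec2[where F = "\<lambda>x. 0" and G = "\<lambda>k y x. y + x"])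
      (auto intro!: recursive_add recursive_nth recursive_const)
qed

lemma recursive_pred:
  assumes "recursive n F"
  shows "recursive n (\<lambda>xs. F xs - 1)"
proof (rule recursive_compose2[of "\<lambda>x y. x - 1", OF _ assms assms])
  show "recursive 2 (\<lambda>xs. xs ! 0 - 1)"
    by (rule recursive_rec2[where F = "\<lambda>x. 0" and G = "\<lambda>k y x. k" and H = "\<lambda>x y. x - 1"])
      (auto intro!: recursive_nth recursive_const)
qed

lemma recursive_diff:
  assumes "recursive n F" "recursive n G"
  shows "recursive n (\<lambda>xs. F xs - G xs)"
\<comment> \<open>The recursion runs over the first argument, which has to be the subtrahend; hence
  the swap.\<close>
proof (rule recursive_compose2[of "\<lambda>x y. y - x", OF _ assms(2,1)])
  show "recursive 2 (\<lambda>xs. xs ! 1 - xs ! 0)"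
    by (rule recursive_rec2[where F = "\<lambda>x. x" and G = "\<lambda>k y x. y - 1" and H = "\<lambda>x y. y - x"])
      (auto intro!: recursive_pred[unfolded One_nat_def] recursive_nth)
qed

lemma recursive_triangle:
  assumes "recursive n F"
  shows "recursive n (\<lambda>xs. triangle (F xs))"
proof (rule recursive_compose2[of "\<lambda>x y. triangle x", OF _ assms assms])
  show "recursive 2 (\<lambda>xs. triangle (xs ! 0))"
    by (rule recursive_rec2[where F = "\<lambda>x. 0" and G = "\<lambda>k y x. y + Suc k" and H = "\<lambda>x y. triangle x"])
      (auto intro!: recursive_add recursive_Suc recursive_nth recursive_const)
qed

lemma recursive_prod_encode:
  assumes "recursive n F" "recursive n G"
  shows "recursive n (\<lambda>xs. prod_encode (F xs, G xs))"
  unfolding prod_encode_def using assms by (auto intro!: recursive_add recursive_triangle)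

section \<open>Computable functions of one argument\<close>

text \<open>Several arguments are passed as iterated pairs, so that contexts of any length are numbers.\<close>

definition computable :: "(nat \<Rightarrow> nat) \<Rightarrow> bool" where
  "computable F \<longleftrightarrow> recursive 1 (\<lambda>xs. F (xs ! 0))"

lemma recursive_computable: "computable F \<Longrightarrow> recursive n G \<Longrightarrow> recursive n (\<lambda>xs. F (G xs))"
  unfolding computable_def by (rule recursive_compose1)

lemma computable_compose: "computable F \<Longrightarrow> computable G \<Longrightarrow> computable (\<lambda>x. F (G x))"
  using recursive_computable unfolding computable_def .

lemma computable_id: "computable (\<lambda>x. x)"
  unfolding computable_def by (simp add: recursive_nth)

lemma computable_const: "computable (\<lambda>x. c)"
  unfolding computable_def by (rule recursive_const)

lemma computable_Suc: "computable F \<Longrightarrow> computable (\<lambda>x. Suc (F x))"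
  unfolding computable_def by (rule recursive_Suc)

lemma computable_add: "computable F \<Longrightarrow> computable G \<Longrightarrow> computable (\<lambda>x. F x + G x)"
  unfolding computable_def by (rule recursive_add)

lemma computable_mult: "computable F \<Longrightarrow> computable G \<Longrightarrow> computable (\<lambda>x. F x * G x)"
  unfolding computable_def by (rule recursive_mult)

lemma computable_diff: "computable F \<Longrightarrow> computable G \<Longrightarrow> computable (\<lambda>x. F x - G x)"
  unfolding computable_def by (rule recursive_diff)

lemma computable_prod_encode:
  "computable F \<Longrightarrow> computable G \<Longrightarrow> computable (\<lambda>x. prod_encode (F x, G x))"
  unfolding computable_def by (rule recursive_prod_encode)

text \<open>A product vanishes iff one factor does. With zero coding truth, this is the bounded
  existential quantifier.\<close>

lemma recursive_bounded_prod:
  assumes "recursive 2 (\<lambda>xs. F (xs ! 0) (xs ! 1))"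
  shows "recursive 2 (\<lambda>xs. \<Prod>y<xs ! 0. F y (xs ! 1))"
  by (rule recursive_rec2[where F = "\<lambda>x. 1" and G = "\<lambda>k y x. y * F k x" and H = "\<lambda>k x. \<Prod>y<k. F y x"])
    (auto intro!: recursive_mult recursive_const recursive_nth recursive_compose2[OF assms] simp: mult.commute)

lemma computable_Least2:
  assumes "recursive 2 (\<lambda>xs. F (xs ! 0) (xs ! 1))" and "\<And>x. \<exists>y. F y x = 0"
  shows "computable (\<lambda>x. LEAST y. F y x = 0)"
proof -
  have "recursive 1 (\<lambda>xs. LEAST y. F ((y # xs) ! 0) ((y # xs) ! 1) = 0)"
    by (rule recursive_Least) (use assms in \<open>auto simp: numeral_2_eq_2\<close>)
  then show ?thesis by (simp add: computable_def)
qed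

section \<open>Inverting the Cantor pairing\<close>

lemma triangle_mono: "i \<le> j \<Longrightarrow> triangle i \<le> triangle j"
  by (induction rule: dec_induct) auto

text \<open>The code of (a, b) is \<open>triangle (a + b) + a\<close>, so a + b is the least n with
  x < \<open>triangle (Suc n)\<close>. The truncated difference expresses this inequality as a zero
  test.\<close>

lemma prod_decode_via_triangle:
  defines "n \<equiv> \<lambda>x. LEAST n. Suc x - triangle (Suc n) = 0"
  shows "fst (prod_decode x) = x - triangle (n x)"
    and "snd (prod_decode x) = n x - (x - triangle (n x))"
proof -
  obtain a b where ab: "prod_decode x = (a, b)" by (rule prod.exhaust)
  then have "x = prod_encode (a, b)" by (metis prod_decode_inverse)
  then have x: "x = triangle (a + b) + a" by (simp add: prod_encode_def)
  have "n x = a + b"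
    unfolding n_def
  proof (rule Least_equality)
    show "Suc x - triangle (Suc (a + b)) = 0" using x by simp
    show "a + b \<le> i" if "Suc x - triangle (Suc i) = 0" for i
      using that x triangle_mono[of "Suc i" "a + b"] by linarith
  qed
  then show "fst (prod_decode x) = x - triangle (n x)"
    and "snd (prod_decode x) = n x - (x - triangle (n x))"
    using ab x by simp_all
qed

lemma computable_triangle_root: "computable (\<lambda>x. LEAST n. Suc x - triangle (Suc n) = 0)"
proof (rule computable_Least2)
  show "recursive 2 (\<lambda>xs. Suc (xs ! 1) - triangle (Suc (xs ! 0)))"
    by (intro recursive_diff recursive_triangle recursive_Suc recursive_nth) auto
  have "x \<le> triangle x" for x by (induction x) auto
  then show "\<exists>n. Suc x - triangle (Suc n) = 0" for x by (metis diff_is_0_eq)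
qed

lemma computable_triangle: "computable F \<Longrightarrow> computable (\<lambda>x. triangle (F x))"
  unfolding computable_def by (rule recursive_triangle)

lemma computable_fst: "computable F \<Longrightarrow> computable (\<lambda>x. fst (prod_decode (F x)))"
  by (rule computable_compose[of "\<lambda>x. fst (prod_decode x)"])
    (auto simp only: prod_decode_via_triangle
      intro!: computable_diff computable_triangle computable_triangle_root computable_id)

lemma computable_snd: "computable F \<Longrightarrow> computable (\<lambda>x. snd (prod_decode (F x)))"
  by (rule computable_compose[of "\<lambda>x. snd (prod_decode x)"])
    (auto simp only: prod_decode_via_triangle
      intro!: computable_diff computable_triangle computable_triangle_root computable_id)

lemma computable_bounded_prod:
  assumes "computable (\<lambda>z. F (fst (prod_decode z)) (snd (prod_decode z)))" and "computable G"
  shows "computable (\<lambda>x. \<Prod>y<G x. F y x)"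
proof -
  have "recursive 2 (\<lambda>xs. F (xs ! 0) (xs ! 1))"
    using recursive_computable[OF assms(1) recursive_prod_encode[of 2 "\<lambda>xs. xs ! 0" "\<lambda>xs. xs ! 1"]]
    by (simp add: recursive_nth)
  from recursive_compose2[OF recursive_bounded_prod[OF this], of 1 "\<lambda>xs. G (xs ! 0)" "\<lambda>xs. xs ! 0"]
  show ?thesis using assms(2) by (simp add: computable_def recursive_nth)
qed

lemma computable_div_2: "computable F \<Longrightarrow> computable (\<lambda>x. F x div 2)"
proof (rule computable_compose[of "\<lambda>x. x div 2"])
  \<comment> \<open>The test says x \<le> 2y + 1, that is, x div 2 \<le> y.\<close>
  have "(LEAST y. x - Suc (y + y) = 0) = x div 2" for x :: nat
    by (rule Least_equality) auto
  moreover have "computable (\<lambda>x. LEAST y. x - Suc (y + y) = 0)"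
  proof (rule computable_Least2)
    show "recursive 2 (\<lambda>xs. xs ! 1 - Suc (xs ! 0 + xs ! 0))"
      by (intro recursive_diff recursive_add recursive_Suc recursive_nth) auto
    show "\<exists>y. x - Suc (y + y) = 0" for x :: nat
      by (rule exI[of _ x]) simp
  qed
  ultimately show "computable (\<lambda>x. x div 2)" by simp
qed

text \<open>Iterated halving. Since \<open>set_decode\<close> takes \<open>y\<close> as an element
  of \<open>x\<close> iff \<open>x div 2 ^ y\<close> is odd, this makes membership in a coded finite
  set decidable.\<close>

lemma computable_div_power_2:
  assumes "computable F" and "computable G"
  shows "computable (\<lambda>x. F x div 2 ^ G x)"
proof -
  have "recursive 2 (\<lambda>xs. xs ! 1 div 2 ^ (xs ! 0))"
    by (rule recursive_rec2[where F = "\<lambda>x. x" and G = "\<lambda>k y x. y div 2" and H = "\<lambda>k x. x div 2 ^ k"])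
      (auto intro!: recursive_nth recursive_computable[OF computable_div_2[OF computable_id]]
        simp: mult.commute simp flip: div_mult2_eq)
  from recursive_compose2[OF this, of 1 "\<lambda>xs. G (xs ! 0)" "\<lambda>xs. F (xs ! 0)"]
  show ?thesis using assms by (simp add: computable_def)
qed

section \<open>Decidable and recursively enumerable predicates\<close>

text \<open>Zero stands for truth, matching the zero sought by \<open>Mn\<close>; conjunction
  becomes addition and bounded existence a product.\<close>

definition decidable :: "(nat \<Rightarrow> bool) \<Rightarrow> bool" where
  "decidable R \<longleftrightarrow> (\<exists>F. computable F \<and> (\<forall>x. R x \<longleftrightarrow> F x = 0))"

lemma decidableI: "computable F \<Longrightarrow> (\<And>x. R x \<longleftrightarrow> F x = 0) \<Longrightarrow> decidable R"
  unfolding decidable_def by blast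

lemma decidable_compose: "decidable R \<Longrightarrow> computable F \<Longrightarrow> decidable (\<lambda>x. R (F x))"
  unfolding decidable_def using computable_compose by blast

lemma decidable_not: "decidable R \<Longrightarrow> decidable (\<lambda>x. \<not> R x)"
  unfolding decidable_def
  by (elim exE conjE) (rule exI[of _ "\<lambda>x. 1 - _ x"], auto intro!: computable_diff computable_const)

lemma decidable_conj:
  assumes "decidable R" "decidable S"
  shows "decidable (\<lambda>x. R x \<and> S x)"
proof -
  obtain F G where "computable F" "computable G" "\<And>x. R x \<longleftrightarrow> F x = 0" "\<And>x. S x \<longleftrightarrow> G x = 0"
    using assms unfolding decidable_def by blast
  then show ?thesis by (intro decidableI[of "\<lambda>x. F x + G x"]) (auto intro: computable_add)
qed

lemma decidable_disj: "decidable R \<Longrightarrow> decidable S \<Longrightarrow> decidable (\<lambda>x. R x \<or> S x)"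
  using decidable_not[OF decidable_conj[OF decidable_not decidable_not]] by simp

lemma decidable_eq:
  assumes "computable F" "computable G"
  shows "decidable (\<lambda>x. F x = G x)"
  by (rule decidableI[of "\<lambda>x. (F x - G x) + (G x - F x)"])
    (use assms in \<open>auto intro: computable_add computable_diff\<close>)

lemma decidable_less:
  assumes "computable F" "computable G"
  shows "decidable (\<lambda>x. F x < G x)"
  by (rule decidableI[of "\<lambda>x. Suc (F x) - G x"])
    (use assms in \<open>auto intro: computable_Suc computable_diff\<close>)

text \<open>The bound variable is paired in front of the context \<open>x\<close>, like de Bruijn
  index 0. All later quantifier lemmas have this shape, so nested quantifiers are handled by
  repeated pairing.\<close>

lemma decidable_bex:
  assumes "decidable (\<lambda>z. R (fst (prod_decode z)) (snd (prod_decode z)))" and "computable G"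
  shows "decidable (\<lambda>x. \<exists>y<G x. R y x)"
proof -
  obtain F where F: "computable F" "\<And>z. R (fst (prod_decode z)) (snd (prod_decode z)) \<longleftrightarrow> F z = 0"
    using assms(1) unfolding decidable_def by blast
  have R: "R y x \<longleftrightarrow> F (prod_encode (y, x)) = 0" for x y
    using F(2)[of "prod_encode (y, x)"] by simp
  show ?thesis
    by (rule decidableI[of "\<lambda>x. \<Prod>y<G x. F (prod_encode (y, x))"])
      (use F(1) assms(2) in \<open>auto simp: R intro: computable_bounded_prod\<close>)
qed

lemma decidable_ball:
  assumes "decidable (\<lambda>z. R (fst (prod_decode z)) (snd (prod_decode z)))" and "computable G"
  shows "decidable (\<lambda>x. \<forall>y<G x. R y x)"
  using decidable_not[OF decidable_bex[OF decidable_not[OF assms(1)] assms(2)]] by simp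

lemma decidable_set_decode:
  assumes "computable F" "computable G"
  shows "decidable (\<lambda>x. F x \<in> set_decode (G x))"
proof -
  have "odd n \<longleftrightarrow> n \<noteq> n div 2 + n div 2" for n :: nat by presburger
  then show ?thesis
    unfolding set_decode_def mem_Collect_eq
    using assms by (auto intro!: decidable_not decidable_eq computable_add computable_div_2 computable_div_power_2)
qed

text \<open>A projection of a decidable relation rather than the domain of a partial function:
  witnesses can be paired and bounded, which is what the closure proofs do.\<close>

definition re :: "(nat \<Rightarrow> bool) \<Rightarrow> bool" where
  "re R \<longleftrightarrow> (\<exists>Q. decidable Q \<and> (\<forall>x. R x \<longleftrightarrow> (\<exists>w. Q (prod_encode (w, x)))))"

lemma reI: "decidable Q \<Longrightarrow> (\<And>x. R x \<longleftrightarrow> (\<exists>w. Q (prod_encode (w, x)))) \<Longrightarrow> re R"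
  unfolding re_def by blast

lemma re_nat_re:
  assumes "re R"
  shows "re_nat {x. R x}"
proof -
  obtain Q where Q: "decidable Q" and R: "\<And>x. R x \<longleftrightarrow> (\<exists>w. Q (prod_encode (w, x)))"
    using assms unfolding re_def by blast
  obtain F where F: "computable F" "\<And>x. Q x \<longleftrightarrow> F x = 0"
    using Q unfolding decidable_def by blast
  have "recursive 2 (\<lambda>xs. F (prod_encode (xs ! 0, xs ! 1)))"
    by (rule recursive_computable[OF F(1)]) (auto intro!: recursive_prod_encode recursive_nth)
  then obtain f where f: "computes f (Suc 1) (\<lambda>xs. F (prod_encode (xs ! 0, xs ! 1)))"
    unfolding recursive_def by (auto simp: numeral_2_eq_2)
  have "R x \<longleftrightarrow> (\<exists>y. eval (Mn f) [x] y)" for x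
  proof -
    have "R x \<longleftrightarrow> (\<exists>w. F (prod_encode (w, x)) = 0)" using R F(2) by simp
    also have "\<dots> \<longleftrightarrow> (\<exists>w. F (prod_encode (w, x)) = 0 \<and> (\<forall>i<w. F (prod_encode (i, x)) \<noteq> 0))"
      \<comment> \<open>\<open>Mn\<close> wants all smaller values to be nonzero, so the least
        witness is taken.\<close>
      by (rule exists_least_iff)
    finally show ?thesis by (simp add: eval_Mn_iff[OF f])
  qed
  then show ?thesis unfolding re_nat_def by auto
qed

lemmas computable_intros = computable_id computable_const computable_Suc computable_add
  computable_mult computable_prod_encode computable_fst computable_snd

lemma re_decidable:
  assumes "decidable R"
  shows "re R"
proof (rule reI)
  show "decidable (\<lambda>z. R (snd (prod_decode z)))"
    by (intro decidable_compose[OF assms] computable_intros)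
qed simp

lemma re_compose:
  assumes "re R" and "computable F"
  shows "re (\<lambda>x. R (F x))"
proof -
  obtain Q where Q: "decidable Q" and R: "\<And>x. R x \<longleftrightarrow> (\<exists>w. Q (prod_encode (w, x)))"
    using assms(1) unfolding re_def by blast
  show ?thesis
  proof (rule reI)
    show "decidable (\<lambda>z. Q (prod_encode (fst (prod_decode z), F (snd (prod_decode z)))))"
      by (intro decidable_compose[OF Q] computable_intros computable_compose[OF assms(2)])
  qed (simp add: R)
qed

lemma re_compose2:
  assumes "re (\<lambda>z. R (fst (prod_decode z)) (snd (prod_decode z)))" and "computable F" and "computable G"
  shows "re (\<lambda>x. R (F x) (G x))"
  using re_compose[OF assms(1) computable_prod_encode[OF assms(2,3)]] by simp

lemma re_ex:
  assumes "re (\<lambda>z. R (fst (prod_decode z)) (snd (prod_decode z)))"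
  shows "re (\<lambda>x. \<exists>y. R y x)"
proof -
  obtain Q where Q: "decidable Q"
    and R: "\<And>z. R (fst (prod_decode z)) (snd (prod_decode z)) \<longleftrightarrow> (\<exists>w. Q (prod_encode (w, z)))"
    using assms unfolding re_def by blast
  have R': "R y x \<longleftrightarrow> (\<exists>w. Q (prod_encode (w, prod_encode (y, x))))" for x y
    using R[of "prod_encode (y, x)"] by simp
  let ?Q = "\<lambda>z. Q (prod_encode (fst (prod_decode (fst (prod_decode z))),
      prod_encode (snd (prod_decode (fst (prod_decode z))), snd (prod_decode z))))"
  show ?thesis
  proof (rule reI[of ?Q])
    show "decidable ?Q" by (intro decidable_compose[OF Q] computable_intros)
    show "(\<exists>y. R y x) \<longleftrightarrow> (\<exists>w. ?Q (prod_encode (w, x)))" for x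
      unfolding R' prod_encode_inverse fst_conv snd_conv
      by (metis prod_encode_inverse fst_conv snd_conv)
  qed
qed

lemma re_conj:
  assumes "re R" "re S"
  shows "re (\<lambda>x. R x \<and> S x)"
proof -
  obtain Q Q' where Q: "decidable Q" "\<And>x. R x \<longleftrightarrow> (\<exists>w. Q (prod_encode (w, x)))"
    and Q': "decidable Q'" "\<And>x. S x \<longleftrightarrow> (\<exists>w. Q' (prod_encode (w, x)))"
    using assms unfolding re_def by metis
  have "re (\<lambda>x. \<exists>v w. Q (prod_encode (v, x)) \<and> Q' (prod_encode (w, x)))"
    by (intro re_ex re_decidable decidable_conj decidable_compose[OF Q(1)] decidable_compose[OF Q'(1)]
        computable_intros)
  then show ?thesis by (simp add: Q(2) Q'(2))
qed

lemma re_disj: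
  assumes "re R" "re S"
  shows "re (\<lambda>x. R x \<or> S x)"
proof -
  obtain Q Q' where Q: "decidable Q" "\<And>x. R x \<longleftrightarrow> (\<exists>w. Q (prod_encode (w, x)))"
    and Q': "decidable Q'" "\<And>x. S x \<longleftrightarrow> (\<exists>w. Q' (prod_encode (w, x)))"
    using assms unfolding re_def by metis
  show ?thesis
    by (rule reI[OF decidable_disj[OF Q(1) Q'(1)]]) (auto simp: Q(2) Q'(2))
qed

lemma re_bounded_all:
  assumes "re (\<lambda>z. R (fst (prod_decode z)) (snd (prod_decode z)))" and "computable G"
  shows "re (\<lambda>x. \<forall>y<G x. R y x)"
proof -
  obtain Q where Q: "decidable Q"
    and R: "\<And>z. R (fst (prod_decode z)) (snd (prod_decode z)) \<longleftrightarrow> (\<exists>w. Q (prod_encode (w, z)))"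
    using assms(1) unfolding re_def by blast
  have R': "R y x \<longleftrightarrow> (\<exists>w. Q (prod_encode (w, prod_encode (y, x))))" for x y
    using R[of "prod_encode (y, x)"] by simp
  \<comment> \<open>Finitely many witnesses have a common bound. Guessing it first leaves only
    bounded quantifiers over a decidable relation.\<close>
  have collect: "(\<forall>y<n. \<exists>w. T y w) \<longleftrightarrow> (\<exists>b. \<forall>y<n. \<exists>w<b. T y w)" for n :: nat and T :: "nat \<Rightarrow> nat \<Rightarrow> bool"
  proof
    assume "\<forall>y<n. \<exists>w. T y w"
    then obtain f where "\<forall>y<n. T y (f y)" by metis
    moreover have "f y < Suc (Max (f ` {..<n}))" if "y < n" for y
      using that by (auto simp: less_Suc_eq_le intro!: Max_ge)
    ultimately show "\<exists>b. \<forall>y<n. \<exists>w<b. T y w" by blast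
  qed blast
  have "re (\<lambda>x. \<exists>b. \<forall>y<G x. \<exists>w<b. Q (prod_encode (w, prod_encode (y, x))))"
    by (intro re_ex re_decidable decidable_ball decidable_bex decidable_compose[OF Q]
        computable_compose[OF assms(2)] computable_intros)
  moreover have "(\<forall>y<G x. R y x) \<longleftrightarrow> (\<exists>b. \<forall>y<G x. \<exists>w<b. Q (prod_encode (w, prod_encode (y, x))))" for x
    unfolding R' by (rule collect)
  ultimately show ?thesis by (simp only:)
qed

text \<open>\<open>S\<close> is a fixed finite set of any type and is not coded. Quantifiers over
  the rules of \<open>P\<close>, the literals of a body or the symbols of the language are unfolded
  into finite combinations in this way.\<close>

lemma re_finite_ex:
  assumes "finite S" and "\<And>a. a \<in> S \<Longrightarrow> re (R a)"
  shows "re (\<lambda>x. \<exists>a\<in>S. R a x)"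
  using assms
proof (induction S)
  case empty
  have "decidable (\<lambda>x. 0 = (1::nat))" by (intro decidable_eq computable_intros)
  then show ?case using re_decidable by simp
next
  case (insert a S)
  then show ?case by (simp add: re_disj)
qed

lemma re_True: "re (\<lambda>x. True)"
  using re_decidable[OF decidable_eq[OF computable_id computable_id]] by simp

lemma re_finite_all:
  assumes "finite S" and "\<And>a. a \<in> S \<Longrightarrow> re (R a)"
  shows "re (\<lambda>x. \<forall>a\<in>S. R a x)"
  using assms by (induction S) (simp_all add: re_True re_conj)

lemma re_eq: "computable F \<Longrightarrow> computable G \<Longrightarrow> re (\<lambda>x. F x = G x)"
  by (rule re_decidable[OF decidable_eq])

lemma re_mem_set_decode: "computable F \<Longrightarrow> computable G \<Longrightarrow> re (\<lambda>x. F x \<in> set_decode (G x))"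
  by (rule re_decidable[OF decidable_set_decode])

lemma mem_set_decode_less: "y \<in> set_decode w \<Longrightarrow> y < w"
proof -
  assume "y \<in> set_decode w"
  then have "w div 2 ^ y \<noteq> 0" by (auto simp: set_decode_def intro: ccontr)
  then have "2 ^ y \<le> w" by (simp add: div_eq_0_iff)
  moreover have "y < 2 ^ y" by simp
  ultimately show "y < w" by linarith
qed

lemma re_ball_set_decode:
  assumes "re (\<lambda>z. R (fst (prod_decode z)) (snd (prod_decode z)))" and "computable G"
  shows "re (\<lambda>x. \<forall>y\<in>set_decode (G x). R y x)"
proof -
  have "re (\<lambda>x. \<forall>y<G x. y \<notin> set_decode (G x) \<or> R y x)"
    by (intro re_bounded_all re_disj assms re_decidable[OF decidable_not[OF decidable_set_decode]]
        computable_compose[OF assms(2)] computable_intros)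
  moreover have "(\<forall>y\<in>set_decode w. T y) \<longleftrightarrow> (\<forall>y<w. y \<notin> set_decode w \<or> T y)" for w and T :: "nat \<Rightarrow> bool"
    using mem_set_decode_less by blast
  ultimately show ?thesis by simp
qed

section \<open>Inductively generated predicates\<close>

text \<open>In \<open>St x w\<close> the finite set of premises of an inference step with conclusion \<open>x\<close> is coded by \<open>w\<close>.\<close>

inductive derivable :: "(nat \<Rightarrow> nat \<Rightarrow> bool) \<Rightarrow> nat \<Rightarrow> bool" for St where
  "St x w \<Longrightarrow> (\<And>y. y \<in> set_decode w \<Longrightarrow> derivable St y) \<Longrightarrow> derivable St x"

text \<open>A derivation is a finite set of pairs \<open>(x, r)\<close> in which \<open>x\<close> follows from premises of smaller
  rank than \<open>r\<close>.\<close>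

definition derivation :: "(nat \<Rightarrow> nat \<Rightarrow> bool) \<Rightarrow> nat set \<Rightarrow> bool" where
  "derivation St W \<longleftrightarrow> (\<forall>p\<in>W. \<exists>w. St (fst (prod_decode p)) w \<and>
     (\<forall>y\<in>set_decode w. \<exists>r<snd (prod_decode p). prod_encode (y, r) \<in> W))"

lemma derivable_iff_derivation:
  "derivable St x \<longleftrightarrow> (\<exists>W r. derivation St (set_decode W) \<and> prod_encode (x, r) \<in> set_decode W)"
proof
  assume "derivable St x"
  then have "\<exists>W r. finite W \<and> derivation St W \<and> prod_encode (x, r) \<in> W"
  proof induction
    case (1 x w)
    then obtain V q where V: "\<And>y. y \<in> set_decode w \<Longrightarrow>
        finite (V y) \<and> derivation St (V y) \<and> prod_encode (y, q y) \<in> V y" by metis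
    \<comment> \<open>The same number may occur with several ranks, so the union of derivations of
      the premises is again a derivation and nothing has to be reconciled; the new rank only has to
      exceed those of the premises.\<close>
    define W where "W = (\<Union>y\<in>set_decode w. V y)"
    define r where "r = Suc (Max (q ` set_decode w))"
    have q: "q y < r" if "y \<in> set_decode w" for y
      using that by (auto simp: r_def less_Suc_eq_le intro!: Max_ge)
    have "derivation St (insert (prod_encode (x, r)) W)"
      unfolding derivation_def
    proof
      fix p
      assume "p \<in> insert (prod_encode (x, r)) W"
      then consider "p = prod_encode (x, r)" | y where "y \<in> set_decode w" "p \<in> V y"
        by (auto simp: W_def)
      then show "\<exists>w. St (fst (prod_decode p)) w \<and>
          (\<forall>y\<in>set_decode w. \<exists>s<snd (prod_decode p). prod_encode (y, s) \<in> insert (prod_encode (x, r)) W)"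
      proof cases
        case 1
        have "\<exists>s<r. prod_encode (y, s) \<in> insert (prod_encode (x, r)) W" if "y \<in> set_decode w" for y
          using V[OF that] q[OF that] that unfolding W_def by blast
        then show ?thesis using 1 \<open>St x w\<close> by (intro exI[of _ w]) simp
      next
        case 2
        then have "derivation St (V y)" using V by blast
        then obtain v where v: "St (fst (prod_decode p)) v"
            "\<forall>y'\<in>set_decode v. \<exists>s<snd (prod_decode p). prod_encode (y', s) \<in> V y"
          using 2(2) unfolding derivation_def by blast
        have "V y \<subseteq> insert (prod_encode (x, r)) W" using 2(1) by (auto simp: W_def)
        then show ?thesis using v by blast
      qed
    qed
    moreover have "finite W" using V by (auto simp: W_def)
    ultimately show ?case by blast
  qed
  then show "\<exists>W r. derivation St (set_decode W) \<and> prod_encode (x, r) \<in> set_decode W"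
    by (metis set_encode_inverse)
next
  assume "\<exists>W r. derivation St (set_decode W) \<and> prod_encode (x, r) \<in> set_decode W"
  then obtain W r where W: "derivation St W" and "prod_encode (x, r) \<in> W" by blast
  from this(2) show "derivable St x"
  proof (induction r arbitrary: x rule: less_induct)
    case (less r)
    then obtain w where "St x w" "\<forall>y\<in>set_decode w. \<exists>s<r. prod_encode (y, s) \<in> W"
      using W unfolding derivation_def by force
    then show ?case using less.IH by (blast intro: derivable.intros)
  qed
qed

text \<open>A derivation is a finite set, hence a single number to be guessed, and its correctness
  is a bounded check. Coded lists, ground terms and supports are presented as inference systems in
  order to use this.\<close>

lemma re_derivable:
  assumes "re (\<lambda>z. St (fst (prod_decode z)) (snd (prod_decode z)))"
  shows "re (derivable St)"
proof -
  have "re (\<lambda>x. \<exists>W r. derivation St (set_decode W) \<and> prod_encode (x, r) \<in> set_decode W)"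
    unfolding derivation_def
    by (intro re_ex re_conj re_ball_set_decode re_mem_set_decode re_compose2[OF assms]
        re_decidable[OF decidable_less] computable_intros)
  then show ?thesis by (simp add: derivable_iff_derivation[abs_def])
qed

text \<open>Inferences with one premise \<open>n\<close> use the premise code \<open>2 ^ n\<close>;
  axioms use 0, which codes the empty set.\<close>

lemma set_decode_power_2: "set_decode (2 ^ n) = {n}"
  using set_encode_inverse[of "{n}"] by simp

text \<open>A nonempty list is coded as the successor of the pair of its head and the code of its
  tail. An inference finds the element at the head or passes to the tail.\<close>

lemma re_mem_list:
  assumes "computable F" and "computable G"
  shows "re (\<lambda>x. F x \<in> set (list_decode (G x)))"
proof -
  define St where "St = (\<lambda>z w. \<exists>a r. snd (prod_decode z) = Suc (prod_encode (a, r)) \<and>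
    (a = fst (prod_decode z) \<or> prod_encode (fst (prod_decode z), r) \<in> set_decode w))"
  have re: "re (derivable St)"
    unfolding St_def
    by (intro re_derivable re_ex re_conj re_disj re_eq re_mem_set_decode computable_intros)
  have "derivable St (prod_encode (b, list_encode bs))" if "b \<in> set bs" for b bs
    using that
  proof (induction bs)
    case (Cons c bs)
    show ?case
    proof (cases "b = c")
      case True
      then show ?thesis by - (rule derivable.intros[of _ _ 0], auto simp: St_def)
    next
      case False
      then have "derivable St (prod_encode (b, list_encode bs))" using Cons by simp
      then show ?thesis
        by - (rule derivable.intros[of _ _ "2 ^ prod_encode (b, list_encode bs)"], auto simp: St_def set_decode_power_2)
    qed
  qed simp
  moreover have "fst (prod_decode z) \<in> set (list_decode (snd (prod_decode z)))" if "derivable St z" for z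
    using that
  proof induction
    case (1 z w)
    then show ?case unfolding St_def by force
  qed
  ultimately have "b \<in> set (list_decode l) \<longleftrightarrow> derivable St (prod_encode (b, l))" for b l
    by (metis fst_conv snd_conv prod_encode_inverse list_decode_inverse)
  then show ?thesis using re_compose[OF re computable_prod_encode[OF assms]] by simp
qed

lemma re_ball_list:
  assumes "re (\<lambda>z. R (fst (prod_decode z)) (snd (prod_decode z)))" and "computable G"
  shows "re (\<lambda>x. \<forall>y\<in>set (list_decode (G x)). R y x)"
proof -
  define St where "St = (\<lambda>z w. fst (prod_decode z) = 0 \<or>
    (\<exists>a r. fst (prod_decode z) = Suc (prod_encode (a, r)) \<and> R a (snd (prod_decode z)) \<and>
      prod_encode (r, snd (prod_decode z)) \<in> set_decode w))"
  have re: "re (derivable St)"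
    unfolding St_def
    by (intro re_derivable re_ex re_conj re_disj re_eq re_mem_set_decode re_compose2[OF assms(1)]
        computable_intros)
  have "derivable St (prod_encode (list_encode bs, x))" if "\<forall>y\<in>set bs. R y x" for bs x
    using that
  proof (induction bs)
    case Nil
    show ?case by - (rule derivable.intros[of _ _ 0], auto simp: St_def)
  next
    case (Cons c bs)
    then have "derivable St (prod_encode (list_encode bs, x))" by simp
    then show ?case using Cons.prems
      by - (rule derivable.intros[of _ _ "2 ^ prod_encode (list_encode bs, x)"], auto simp: St_def set_decode_power_2)
  qed
  moreover have "\<forall>y\<in>set (list_decode (fst (prod_decode z))). R y (snd (prod_decode z))"
    if "derivable St z" for z
    using that
  proof induction
    case (1 z w)
    then show ?case unfolding St_def by force
  qed
  ultimately have "(\<forall>y\<in>set (list_decode l). R y x) \<longleftrightarrow> derivable St (prod_encode (l, x))" for l x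
    by (metis fst_conv snd_conv prod_encode_inverse list_decode_inverse)
  then show ?thesis using re_compose[OF re computable_prod_encode[OF assms(2) computable_id]] by simp
qed

section \<open>Ground instances\<close>

fun vars_atm :: "atm \<Rightarrow> nat set" where
  "vars_atm (Atm p ts) = (\<Union>t\<in>set ts. vars_trm t)"

lemma subst_trm_eq_iff: "subst_trm \<sigma> t = subst_trm \<tau> t \<longleftrightarrow> (\<forall>x\<in>vars_trm t. \<sigma> x = \<tau> x)"
  by (induction t) auto

lemma subst_atm_eq_iff: "subst_atm \<sigma> a = subst_atm \<tau> a \<longleftrightarrow> (\<forall>x\<in>vars_atm a. \<sigma> x = \<tau> x)"
  by (cases a) (auto simp: subst_trm_eq_iff)

lemma subst_lit_cong: "(\<And>x. x \<in> vars_atm (lit_atm L) \<Longrightarrow> \<sigma> x = \<tau> x) \<Longrightarrow> subst_lit \<sigma> L = subst_lit \<tau> L"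
  by (cases L) (auto simp: subst_atm_eq_iff)

lemma lit_atm_subst_lit: "lit_atm (subst_lit \<sigma> L) = subst_atm \<sigma> (lit_atm L)"
  by (cases L) auto

lemma subst_trm_Var: "subst_trm Var t = t"
  by (induction t) (auto intro: map_idI)

lemma subst_atm_Var: "subst_atm Var a = a"
  by (cases a) (auto simp: subst_trm_Var intro: map_idI)

lemma in_hu_Fn: "in_hu P (Fn f ts) \<longleftrightarrow> (f, length ts) \<in> lang P \<and> (\<forall>t\<in>set ts. in_hu P t)"
  by (auto simp: in_hu_def)

lemma in_hu_subst:
  "in_hu P (subst_trm \<sigma> t) \<longleftrightarrow> syms_trm t \<subseteq> lang P \<and> (\<forall>x\<in>vars_trm t. in_hu P (\<sigma> x))"
  by (induction t) (auto simp: in_hu_Fn)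

lemma in_hb_subst:
  "in_hb P (subst_atm \<sigma> a) \<longleftrightarrow> syms_atm a \<subseteq> lang P \<and> (\<forall>x\<in>vars_atm a. in_hu P (\<sigma> x))"
  by (cases a) (auto simp: in_hb_def in_hu_subst)

lemma subst_atm_in_hb:
  assumes "in_hb P a"
  shows "subst_atm \<sigma> a = a"
proof -
  have "vars_atm a = {}" using assms by (cases a) (auto simp: in_hb_def in_hu_def)
  then have "subst_atm \<sigma> a = subst_atm Var a" by (simp add: subst_atm_eq_iff)
  then show ?thesis by (simp add: subst_atm_Var)
qed

lemma ex_in_hu: "\<exists>t. in_hu P t"
proof -
  obtain c where "(c, 0) \<in> lang P"
    unfolding lang_def by (cases "\<exists>c. (c, 0) \<in> syms_prog P") auto
  then have "in_hu P (Fn c [])" by (simp add: in_hu_Fn)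
  then show ?thesis ..
qed

lemma syms_rule_subset_lang:
  assumes "(h, b) \<in> P"
  shows "syms_atm h \<subseteq> lang P" and "L \<in> set b \<Longrightarrow> syms_atm (lit_atm L) \<subseteq> lang P"
proof -
  have "syms_rule (h, b) \<subseteq> lang P" using assms by (auto simp: lang_def syms_prog_def)
  then show "syms_atm h \<subseteq> lang P" and "L \<in> set b \<Longrightarrow> syms_atm (lit_atm L) \<subseteq> lang P"
    by (auto simp: syms_rule_def)
qed

lemma in_hb_Ground:
  assumes "(A, b) \<in> Ground P"
  shows "in_hb P A" and "L \<in> set b \<Longrightarrow> in_hb P (lit_atm L)"
proof -
  obtain \<sigma> h b' where *: "A = subst_atm \<sigma> h" "b = map (subst_lit \<sigma>) b'" "(h, b') \<in> P" "grounding P \<sigma>"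
    using assms unfolding Ground_def by blast
  show "in_hb P A" using *(1,4) syms_rule_subset_lang(1)[OF *(3)] by (auto simp: in_hb_subst grounding_def)
  show "in_hb P (lit_atm L)" if "L \<in> set b"
    using that *(2,4) syms_rule_subset_lang(2)[OF *(3)]
    by (auto simp: in_hb_subst grounding_def lit_atm_subst_lit)
qed

text \<open>Unlike \<open>Ground\<close>, this allows arbitrary substitutions, so that rule
  instances can be found by matching heads alone.\<close>

definition instances :: "rule set \<Rightarrow> rule set" where
  "instances P = {(subst_atm \<sigma> h, map (subst_lit \<sigma>) b) | \<sigma> h b. (h, b) \<in> P}"

text \<open>Not the safety condition of Datalog: every variable of the body must occur in the head,
  so that matching the head determines the whole instance.\<close>

definition safe :: "rule set \<Rightarrow> bool" where
  "safe P \<longleftrightarrow> (\<forall>(h, b)\<in>P. \<forall>L\<in>set b. vars_atm (lit_atm L) \<subseteq> vars_atm h)"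

lemma safeD: "safe P \<Longrightarrow> (h, b) \<in> P \<Longrightarrow> L \<in> set b \<Longrightarrow> x \<in> vars_atm (lit_atm L) \<Longrightarrow> x \<in> vars_atm h"
  unfolding safe_def by blast

lemma Ground_iff_instances:
  assumes "safe P" and "in_hb P A"
  shows "(A, b) \<in> Ground P \<longleftrightarrow> (A, b) \<in> instances P"
proof
  assume "(A, b) \<in> instances P"
  then obtain \<sigma> h b' where *: "A = subst_atm \<sigma> h" "b = map (subst_lit \<sigma>) b'" "(h, b') \<in> P"
    unfolding instances_def by blast
  obtain c where c: "in_hu P c" using ex_in_hu by blast
  \<comment> \<open>On head variables the values are ground because \<open>A\<close> is in the
    Herbrand base. Elsewhere \<open>c\<close> replaces values that neither head nor body can
    see.\<close>
  define \<tau> where "\<tau> = (\<lambda>x. if x \<in> vars_atm h then \<sigma> x else c)"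
  have "grounding P \<tau>" using assms(2) c by (auto simp: grounding_def \<tau>_def *(1) in_hb_subst)
  moreover have "A = subst_atm \<tau> h" by (simp add: *(1) subst_atm_eq_iff \<tau>_def)
  moreover have "b = map (subst_lit \<tau>) b'"
    using safeD[OF assms(1) *(3)] by (auto simp: *(2) \<tau>_def intro!: subst_lit_cong)
  ultimately show "(A, b) \<in> Ground P" using *(3) unfolding Ground_def by blast
qed (auto simp: Ground_def instances_def)

section \<open>Supports\<close>

text \<open>Big-step form of SLD derivations: each positive literal has its own subderivation, so
  inductions follow the goal and ignore the order of resolution. The rule set is a parameter in
  order to cover both \<open>Ground P\<close> and \<open>instances P\<close>.\<close>

inductive goal_support :: "rule set \<Rightarrow> lit list \<Rightarrow> atm set \<Rightarrow> bool" for R where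
  Nil: "goal_support R [] {}"
| Neg: "goal_support R G S \<Longrightarrow> goal_support R (Neg B # G) (insert B S)"
| Pos: "(A, b) \<in> R \<Longrightarrow> goal_support R b S \<Longrightarrow> goal_support R G T \<Longrightarrow> goal_support R (Pos A # G) (S \<union> T)"

inductive_cases goal_support_NilE: "goal_support R [] S"
inductive_cases goal_support_NegE: "goal_support R (Neg B # G) S"
inductive_cases goal_support_PosE: "goal_support R (Pos A # G) S"

lemma goal_support_append:
  "goal_support R (G @ H) S \<longleftrightarrow> (\<exists>T U. goal_support R G T \<and> goal_support R H U \<and> S = T \<union> U)"
proof
  assume "goal_support R (G @ H) S"
  then show "\<exists>T U. goal_support R G T \<and> goal_support R H U \<and> S = T \<union> U"
  proof (induction G arbitrary: S)
    case Nil
    then show ?case using goal_support.Nil by fastforce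
  next
    case (Cons L G)
    show ?case
    proof (cases L)
      case (Pos A)
      then obtain b S1 S2 where "(A, b) \<in> R" "goal_support R b S1" "goal_support R (G @ H) S2" "S = S1 \<union> S2"
        using Cons.prems by (auto elim: goal_support_PosE)
      moreover from this(3) obtain T U where "goal_support R G T" "goal_support R H U" "S2 = T \<union> U"
        using Cons.IH by blast
      ultimately show ?thesis
        unfolding Pos by (intro exI[of _ "S1 \<union> T"] exI[of _ U]) (auto intro: goal_support.Pos)
    next
      case (Neg B)
      then obtain S' where "goal_support R (G @ H) S'" "S = insert B S'"
        using Cons.prems by (auto elim: goal_support_NegE)
      moreover from this(1) obtain T U where "goal_support R G T" "goal_support R H U" "S' = T \<union> U"
        using Cons.IH by blast
      ultimately show ?thesis
        unfolding Neg by (intro exI[of _ "insert B T"] exI[of _ U]) (auto intro: goal_support.Neg)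
    qed
  qed
next
  assume "\<exists>T U. goal_support R G T \<and> goal_support R H U \<and> S = T \<union> U"
  then obtain T U where "goal_support R G T" and H: "goal_support R H U" and S: "S = T \<union> U" by blast
  from this(1) have "goal_support R (G @ H) (T \<union> U)"
    by induction (use H in \<open>auto simp: Un_assoc intro: goal_support.intros\<close>)
  then show "goal_support R (G @ H) S" by (simp add: S)
qed

lemma goal_support_Pos_iff: "goal_support R [Pos A] S \<longleftrightarrow> (\<exists>b. (A, b) \<in> R \<and> goal_support R b S)"
proof
  show "\<exists>b. (A, b) \<in> R \<and> goal_support R b S" if "goal_support R [Pos A] S"
    using that by (auto elim!: goal_support_PosE goal_support_NilE)
  show "goal_support R [Pos A] S" if "\<exists>b. (A, b) \<in> R \<and> goal_support R b S"
    using that goal_support.Pos[OF _ _ goal_support.Nil, of A _ R S] by auto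
qed

lemma goal_support_negative: "\<forall>L\<in>set G. \<exists>B. L = Neg B \<Longrightarrow> goal_support R G {B. Neg B \<in> set G}"
proof (induction G)
  case (Cons L G)
  then obtain B where L: "L = Neg B" by auto
  have "{C. Neg C \<in> set (L # G)} = insert B {C. Neg C \<in> set G}" by (auto simp: L)
  then show ?case using Cons by (simp add: L goal_support.Neg)
qed (simp add: goal_support.Nil)

lemma sld_step_context: "sld_step P G H \<Longrightarrow> sld_step P (xs @ G @ ys) (xs @ H @ ys)"
  unfolding sld_step_def by (metis append.assoc append_Cons)

lemma sld_steps_context: "(sld_step P)\<^sup>*\<^sup>* G H \<Longrightarrow> (sld_step P)\<^sup>*\<^sup>* (xs @ G @ ys) (xs @ H @ ys)"
  by (induction rule: rtranclp_induct) (auto intro: rtranclp.rtrancl_into_rtrancl sld_step_context)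

text \<open>From left to right, the subderivations are run one after another inside the surrounding
  goal. Conversely, SLD steps are undone from the final goal backwards:
  \<open>goal_support_append\<close> isolates the part of the support due to the body, which is then
  attributed to the resolved atom.\<close>

lemma goal_support_iff_sld:
  "goal_support (Ground P) G S \<longleftrightarrow>
    (\<exists>H. (sld_step P)\<^sup>*\<^sup>* G H \<and> (\<forall>L\<in>set H. \<exists>B. L = Neg B) \<and> S = {B. Neg B \<in> set H})"
proof
  assume "goal_support (Ground P) G S"
  then show "\<exists>H. (sld_step P)\<^sup>*\<^sup>* G H \<and> (\<forall>L\<in>set H. \<exists>B. L = Neg B) \<and> S = {B. Neg B \<in> set H}"
  proof induction
    case Nil
    show ?case by (rule exI[of _ "[]"]) simp
  next
    case (Neg G S B)
    then obtain H where H: "(sld_step P)\<^sup>*\<^sup>* G H" "\<forall>L\<in>set H. \<exists>B. L = Neg B" "S = {B. Neg B \<in> set H}"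
      by blast
    have "(sld_step P)\<^sup>*\<^sup>* (Neg B # G) (Neg B # H)"
      using sld_steps_context[OF H(1), of "[Neg B]" "[]"] by simp
    then show ?case using H(2,3) by (intro exI[of _ "Neg B # H"]) auto
  next
    case (Pos A b S G T)
    then obtain H K where H: "(sld_step P)\<^sup>*\<^sup>* b H" "\<forall>L\<in>set H. \<exists>B. L = Neg B" "S = {B. Neg B \<in> set H}"
      and K: "(sld_step P)\<^sup>*\<^sup>* G K" "\<forall>L\<in>set K. \<exists>B. L = Neg B" "T = {B. Neg B \<in> set K}"
      by blast
    have "sld_step P (Pos A # G) (b @ G)"
      unfolding sld_step_def using Pos.hyps(1)
      by (intro exI[of _ "[]"] exI[of _ A] exI[of _ G] exI[of _ b]) simp
    also have "(sld_step P)\<^sup>*\<^sup>* (b @ G) (H @ G)"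
      using sld_steps_context[OF H(1), of "[]" G] by simp
    also have "(sld_step P)\<^sup>*\<^sup>* (H @ G) (H @ K)"
      using sld_steps_context[OF K(1), of H "[]"] by simp
    finally have "(sld_step P)\<^sup>*\<^sup>* (Pos A # G) (H @ K)" by simp
    then show ?case using H(2,3) K(2,3) by (intro exI[of _ "H @ K"]) auto
  qed
next
  assume "\<exists>H. (sld_step P)\<^sup>*\<^sup>* G H \<and> (\<forall>L\<in>set H. \<exists>B. L = Neg B) \<and> S = {B. Neg B \<in> set H}"
  then obtain H where steps: "(sld_step P)\<^sup>*\<^sup>* G H"
    and H: "\<forall>L\<in>set H. \<exists>B. L = Neg B" "S = {B. Neg B \<in> set H}" by blast
  from steps show "goal_support (Ground P) G S"
  proof (induction rule: converse_rtranclp_induct)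
    case base
    show ?case using goal_support_negative[OF H(1)] H(2) by simp
  next
    case (step G G')
    then obtain xs A ys b where *: "G = xs @ Pos A # ys" "(A, b) \<in> Ground P" "G' = xs @ b @ ys"
      unfolding sld_step_def by blast
    then obtain T U V where "goal_support (Ground P) xs T" "goal_support (Ground P) b U"
        "goal_support (Ground P) ys V" "S = T \<union> (U \<union> V)"
      using step.IH by (auto simp: goal_support_append)
    then show ?case unfolding *(1) goal_support_append using *(2) goal_support.Pos by blast
  qed
qed

lemma support_iff_goal_support: "support P A S \<longleftrightarrow> goal_support (Ground P) [Pos A] S"
  unfolding support_def goal_support_iff_sld ..

lemma goal_support_literal:
  assumes "goal_support R G S"
  shows "Neg B \<in> set G \<Longrightarrow> B \<in> S"
    and "Pos A \<in> set G \<Longrightarrow> \<exists>T\<subseteq>S. goal_support R [Pos A] T"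
  using assms
proof induction
  case (Pos A' b S G T)
  {
    case 1
    then show ?case using Pos by auto
  next
    case 2
    then show ?case using Pos by (auto simp: goal_support_Pos_iff)
  }
qed auto

text \<open>One chosen support per atom serves all its occurrences, since supports are sets and the
  union absorbs repetitions.\<close>

lemma goal_supportI:
  assumes "\<And>A. Pos A \<in> set G \<Longrightarrow> goal_support R [Pos A] (f A)"
  shows "goal_support R G ({B. Neg B \<in> set G} \<union> (\<Union>A\<in>{A. Pos A \<in> set G}. f A))"
  using assms
proof (induction G)
  case (Cons L G)
  have IH: "goal_support R G ({B. Neg B \<in> set G} \<union> (\<Union>A\<in>{A. Pos A \<in> set G}. f A))"
    using Cons by simp
  show ?case
  proof (cases L)
    case (Pos A)
    then have "goal_support R ([Pos A] @ G) (f A \<union> ({B. Neg B \<in> set G} \<union> (\<Union>A\<in>{A. Pos A \<in> set G}. f A)))"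
      using Cons.prems[of A] IH unfolding goal_support_append by auto
    moreover have "f A \<union> ({B. Neg B \<in> set G} \<union> (\<Union>A\<in>{A. Pos A \<in> set G}. f A)) =
        {B. Neg B \<in> set (L # G)} \<union> (\<Union>A\<in>{A. Pos A \<in> set (L # G)}. f A)"
      by (auto simp: Pos)
    ultimately show ?thesis by (simp add: Pos)
  next
    case (Neg B)
    have "insert B ({B. Neg B \<in> set G} \<union> (\<Union>A\<in>{A. Pos A \<in> set G}. f A)) =
        {B. Neg B \<in> set (L # G)} \<union> (\<Union>A\<in>{A. Pos A \<in> set (L # G)}. f A)"
      by (auto simp: Neg)
    then show ?thesis using goal_support.Neg[OF IH, of B] by (simp add: Neg)
  qed
qed (simp add: goal_support.Nil)

section \<open>Reachability and blocked sets\<close>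

definition body_edge :: "rule set \<Rightarrow> atm \<Rightarrow> atm \<Rightarrow> bool" where
  "body_edge R A B \<longleftrightarrow> (\<exists>b. (A, b) \<in> R \<and> B \<in> lit_atm ` set b)"

lemma depends_body_edge: "depends P = (body_edge (Ground P))\<^sup>*\<^sup>*"
  by (intro ext) (simp add: depends_def dep_edge_def[abs_def] body_edge_def[abs_def])

lemma goal_support_reachable:
  assumes "goal_support R G S" and "B \<in> S"
  shows "\<exists>L\<in>set G. (body_edge R)\<^sup>*\<^sup>* (lit_atm L) B"
  using assms
proof induction
  case (Pos A b S G T)
  then consider "\<exists>L\<in>set b. (body_edge R)\<^sup>*\<^sup>* (lit_atm L) B" | "\<exists>L\<in>set G. (body_edge R)\<^sup>*\<^sup>* (lit_atm L) B"
    by blast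
  then show ?case
  proof cases
    case 1
    then obtain L where "L \<in> set b" "(body_edge R)\<^sup>*\<^sup>* (lit_atm L) B" by blast
    moreover from this(1) Pos.hyps(1) have "body_edge R A (lit_atm L)" by (auto simp: body_edge_def)
    ultimately show ?thesis by (auto intro: converse_rtranclp_into_rtranclp)
  qed auto
qed auto

text \<open>A finite set \<open>N\<close> closed under this condition witnesses that every support of each of its
  elements meets \<open>K\<close>: no atom of \<open>N\<close> is derivable once the rules blocked by \<open>K\<close> are removed.\<close>

definition blocked :: "rule set \<Rightarrow> atm set \<Rightarrow> atm set \<Rightarrow> bool" where
  "blocked R K N \<longleftrightarrow> (\<forall>A b. A \<in> N \<longrightarrow> (A, b) \<in> R \<longrightarrow>
     (\<exists>L\<in>set b. case L of Neg B \<Rightarrow> B \<in> K | Pos B \<Rightarrow> B \<in> N))"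

text \<open>Atoms of \<open>N\<close> may refer to each other cyclically, but a support arises from
  a finite derivation. Following blocking literals downwards must therefore end at a negative
  literal with atom in \<open>K\<close>.\<close>

lemma blocked_meets:
  assumes "goal_support R G S" and "blocked R K N"
    and "\<exists>L\<in>set G. case L of Neg B \<Rightarrow> B \<in> K | Pos B \<Rightarrow> B \<in> N"
  shows "\<exists>B\<in>K. B \<in> S"
  using assms(1,3)
proof induction
  case (Pos A b S G T)
  show ?case
  proof (cases "A \<in> N")
    case True
    then have "\<exists>B\<in>K. B \<in> S" using Pos assms(2) unfolding blocked_def by blast
    then show ?thesis by blast
  next
    case False
    then show ?thesis using Pos by auto
  qed
qed auto

text \<open>For \<open>N\<close> one takes the reachable atoms all of whose supports meet
  \<open>K\<close>. If a rule for such an atom were not blocked, each of its positive body atoms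
  would have a support avoiding \<open>K\<close>, and together these would give the head a support
  avoiding \<open>K\<close>. Finite reachability makes \<open>N\<close> finite, turning a universal
  condition into one with a finite witness.\<close>

lemma all_supports_meet_iff_blocked:
  assumes "finite {B. (body_edge R)\<^sup>*\<^sup>* A B}"
  shows "(\<forall>S. goal_support R [Pos A] S \<longrightarrow> (\<exists>B\<in>K. B \<in> S)) \<longleftrightarrow>
    (\<exists>N. finite N \<and> A \<in> N \<and> blocked R K N)"
proof
  assume meet: "\<forall>S. goal_support R [Pos A] S \<longrightarrow> (\<exists>B\<in>K. B \<in> S)"
  define N where "N = {C. (body_edge R)\<^sup>*\<^sup>* A C \<and> (\<forall>S. goal_support R [Pos C] S \<longrightarrow> (\<exists>B\<in>K. B \<in> S))}"
  have "blocked R K N"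
    unfolding blocked_def
  proof (intro allI impI, rule ccontr)
    fix C b
    assume C: "C \<in> N" "(C, b) \<in> R"
      and unblocked: "\<not> (\<exists>L\<in>set b. case L of Neg B \<Rightarrow> B \<in> K | Pos B \<Rightarrow> B \<in> N)"
    have "\<exists>S. goal_support R [Pos D] S \<and> \<not> (\<exists>B\<in>K. B \<in> S)" if "Pos D \<in> set b" for D
    proof -
      have "body_edge R C D" unfolding body_edge_def using C(2) that by force
      then have "(body_edge R)\<^sup>*\<^sup>* A D"
        using C(1) by (auto simp: N_def intro: rtranclp.rtrancl_into_rtrancl)
      moreover have "D \<notin> N" using unblocked that by fastforce
      ultimately show ?thesis by (auto simp: N_def)
    qed
    then obtain f where f: "\<And>D. Pos D \<in> set b \<Longrightarrow> goal_support R [Pos D] (f D) \<and> \<not> (\<exists>B\<in>K. B \<in> f D)"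
      by metis
    let ?S = "{B. Neg B \<in> set b} \<union> (\<Union>D\<in>{D. Pos D \<in> set b}. f D)"
    have "goal_support R [Pos C] ?S"
      using goal_supportI[of b R f] f C(2) by (auto simp: goal_support_Pos_iff)
    then obtain B where "B \<in> K" "B \<in> ?S" using C(1) unfolding N_def by blast
    then show False using f unblocked by fastforce
  qed
  moreover have "finite N" using assms by (rule finite_subset[rotated]) (auto simp: N_def)
  moreover have "A \<in> N" using meet by (simp add: N_def)
  ultimately show "\<exists>N. finite N \<and> A \<in> N \<and> blocked R K N" by blast
next
  assume "\<exists>N. finite N \<and> A \<in> N \<and> blocked R K N"
  then obtain N where "A \<in> N" "blocked R K N" by blast
  then show "\<forall>S. goal_support R [Pos A] S \<longrightarrow> (\<exists>B\<in>K. B \<in> S)"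
    using blocked_meets[of R "[Pos A]" _ K N] by simp
qed

section \<open>Finitely recursive programs\<close>

lemma goal_support_in_hb:
  assumes "goal_support (Ground P) [Pos A] S" and "B \<in> S"
  shows "in_hb P B" and "depends P A B"
proof -
  show dep: "depends P A B"
    using goal_support_reachable[OF assms] by (simp add: depends_body_edge)
  have "in_hb P A" using assms(1) by (auto simp: goal_support_Pos_iff in_hb_Ground)
  from dep this show "in_hb P B"
    unfolding depends_body_edge
    by (induction rule: rtranclp_induct) (auto simp: body_edge_def dest: in_hb_Ground(2))
qed

lemma ground_counter_support_iff:
  "ground_counter_support P A K \<longleftrightarrow>
    (\<forall>S. goal_support (Ground P) [Pos A] S \<longrightarrow> (\<exists>B\<in>K. B \<in> S)) \<and>
    (\<forall>B\<in>K. \<exists>S. goal_support (Ground P) [Pos A] S \<and> B \<in> S)"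
  unfolding ground_counter_support_def support_iff_goal_support
  using goal_support_in_hb(1) by blast

lemma finite_ground_counter_support:
  assumes "finitely_recursive P" and "ground_counter_support P A K"
  shows "K \<subseteq> {B. depends P A B}" and "finite K"
proof -
  show sub: "K \<subseteq> {B. depends P A B}"
    using assms(2) unfolding ground_counter_support_iff by (auto dest: goal_support_in_hb(2))
  show "finite K"
  proof (cases "in_hb P A")
    case True
    then show ?thesis using sub assms(1) finite_subset unfolding finitely_recursive_def by blast
  next
    case False
    \<comment> \<open>Heads of ground rules lie in the Herbrand base, so \<open>A\<close> has no
      support and the second condition forces \<open>K\<close> to be empty.\<close>
    then have "\<nexists>S. goal_support (Ground P) [Pos A] S" by (auto simp: goal_support_Pos_iff in_hb_Ground)
    then show ?thesis using assms(2) unfolding ground_counter_support_iff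
      by (metis equals0I finite.emptyI)
  qed
qed

lemma ground_counter_support_not_in_hb:
  assumes "\<not> in_hb P A"
  shows "ground_counter_support P A K \<longleftrightarrow> K = {}"
proof -
  have "\<nexists>S. goal_support (Ground P) [Pos A] S"
    using assms by (auto simp: goal_support_Pos_iff in_hb_Ground)
  then show ?thesis unfolding ground_counter_support_iff by auto
qed

text \<open>If \<open>x\<close> occurs in the body but not in the head, binding it to each of the
  infinitely many Herbrand terms gives pairwise different body atoms below one and the same ground
  head.\<close>

lemma finitely_recursive_safe:
  assumes "finitely_recursive P" and "infinite {t. in_hu P t}"
  shows "safe P"
  unfolding safe_def
proof (clarify, rule ccontr)
  fix h b L x
  assume r: "(h, b) \<in> P" and L: "L \<in> set b" and x: "x \<in> vars_atm (lit_atm L)" "x \<notin> vars_atm h"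
  obtain c where c: "in_hu P c" using ex_in_hu by blast
  define \<sigma> where "\<sigma> = (\<lambda>t. (\<lambda>_. c)(x := t))"
  have ground: "(subst_atm (\<sigma> t) h, map (subst_lit (\<sigma> t)) b) \<in> Ground P" if "in_hu P t" for t
  proof -
    have "grounding P (\<sigma> t)" using c that by (simp add: grounding_def \<sigma>_def)
    then show ?thesis using r unfolding Ground_def by blast
  qed
  define A where "A = subst_atm (\<sigma> c) h"
  have head: "subst_atm (\<sigma> t) h = A" for t
    using x(2) by (auto simp: A_def subst_atm_eq_iff \<sigma>_def)
  have "subst_atm (\<sigma> t) (lit_atm L) \<in> {B. depends P A B}" if "in_hu P t" for t
  proof -
    have "subst_atm (\<sigma> t) (lit_atm L) \<in> lit_atm ` set (map (subst_lit (\<sigma> t)) b)"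
      using L by (auto simp: lit_atm_subst_lit image_image)
    then have "body_edge (Ground P) A (subst_atm (\<sigma> t) (lit_atm L))"
      using ground[OF that, unfolded head] unfolding body_edge_def by blast
    then show ?thesis by (auto simp: depends_body_edge)
  qed
  then have "(\<lambda>t. subst_atm (\<sigma> t) (lit_atm L)) ` {t. in_hu P t} \<subseteq> {B. depends P A B}"
    by auto
  moreover have "inj_on (\<lambda>t. subst_atm (\<sigma> t) (lit_atm L)) {t. in_hu P t}"
    using x(1) by (auto simp: inj_on_def subst_atm_eq_iff \<sigma>_def dest!: bspec[of _ _ x])
  moreover have "finite {B. depends P A B}"
    using assms(1) in_hb_Ground(1)[OF ground[OF c, unfolded head]] unfolding finitely_recursive_def by blast
  ultimately show False using assms(2) finite_imageD finite_subset by blast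
qed

text \<open>An instance whose head is in the Herbrand base is a ground rule, so its body is in the
  base as well and the agreement propagates down the derivation.\<close>

lemma goal_support_Ground_iff_instances:
  assumes "safe P" and "\<forall>L\<in>set G. in_hb P (lit_atm L)"
  shows "goal_support (Ground P) G S \<longleftrightarrow> goal_support (instances P) G S"
proof
  show "goal_support (instances P) G S" if "goal_support (Ground P) G S"
    using that
  proof induction
    case (Pos A b S G T)
    then show ?case using Ground_iff_instances[OF assms(1) in_hb_Ground(1)] goal_support.Pos by blast
  qed (auto intro: goal_support.intros)
  show "goal_support (Ground P) G S" if "goal_support (instances P) G S"
    using that assms(2)
  proof induction
    case (Pos A b S G T)
    then have "(A, b) \<in> Ground P" using Ground_iff_instances[OF assms(1)] by simp
    then show ?case using Pos in_hb_Ground(2) by (auto intro: goal_support.Pos)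
  qed (auto intro: goal_support.intros)
qed

lemma finite_reachable_instances:
  assumes "safe P" and "finitely_recursive P" and "in_hb P A"
  shows "finite {B. (body_edge (instances P))\<^sup>*\<^sup>* A B}"
proof -
  have "(body_edge (Ground P))\<^sup>*\<^sup>* A B \<and> in_hb P B" if "(body_edge (instances P))\<^sup>*\<^sup>* A B" for B
    using that
  proof (induction rule: rtranclp_induct)
    case (step B C)
    then have "body_edge (Ground P) B C"
      using Ground_iff_instances[OF assms(1)] by (auto simp: body_edge_def)
    then show ?case using step.IH in_hb_Ground(2)
      by (auto simp: body_edge_def intro: rtranclp.rtrancl_into_rtrancl)
  qed (simp add: assms(3))
  then have "{B. (body_edge (instances P))\<^sup>*\<^sup>* A B} \<subseteq> {B. depends P A B}"
    by (auto simp: depends_body_edge)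
  then show ?thesis using assms(2,3) finite_subset unfolding finitely_recursive_def by blast
qed

text \<open>Both conjuncts now ask for finite witnesses, and groundness of the rules is no longer
  mentioned: this is the form that gets enumerated.\<close>

lemma ground_counter_support_instances:
  assumes "safe P" and "finitely_recursive P" and "in_hb P A"
  shows "ground_counter_support P A K \<longleftrightarrow>
    (\<exists>N. finite N \<and> A \<in> N \<and> blocked (instances P) K N) \<and>
    (\<forall>B\<in>K. \<exists>S. goal_support (instances P) [Pos A] S \<and> B \<in> S)"
proof -
  have "goal_support (Ground P) [Pos A] S \<longleftrightarrow> goal_support (instances P) [Pos A] S" for S
    using goal_support_Ground_iff_instances[OF assms(1)] assms(3) by simp
  then show ?thesis
    unfolding ground_counter_support_iff
      all_supports_meet_iff_blocked[OF finite_reachable_instances[OF assms], symmetric] by simp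
qed

section \<open>Coding of terms and substitutions\<close>

lemma inj_enc_trm: "enc_trm s = enc_trm t \<Longrightarrow> s = t"
proof (induction s arbitrary: t)
  case (Var x)
  then show ?case by (cases t) (auto, presburger)
next
  case (Fn f ss)
  show ?case
  proof (cases t)
    case (Var x)
    then show ?thesis using Fn.prems by (auto, presburger)
  next
    case t: (Fn g ts)
    then have "f = g" "list_encode (map enc_trm ss) = list_encode (map enc_trm ts)"
      using Fn.prems by (auto simp: prod_encode_eq)
    then have "map enc_trm ss = map enc_trm ts" by (metis list_encode_inverse)
    then have "ss = ts"
      using Fn.IH by (auto simp: list_eq_iff_nth_eq)
    then show ?thesis using \<open>f = g\<close> t by simp
  qed
qed

lemma mem_less_list_encode: "y \<in> set ys \<Longrightarrow> y < list_encode ys"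
proof (induction ys)
  case (Cons x ys)
  then show ?case
    using le_prod_encode_1[of x "list_encode ys"] le_prod_encode_2[of "list_encode ys" x] by fastforce
qed simp

text \<open>As every number codes a term, quantifiers over terms become quantifiers over numbers
  without a test for well-formed codes.\<close>

lemma surj_enc_trm: "\<exists>t. enc_trm t = n"
proof (induction n rule: less_induct)
  case (less n)
  show ?case
  proof (cases "even n")
    case True
    then show ?thesis by (auto elim!: evenE intro: exI[of _ "Var _"])
  next
    case False
    then obtain m where m: "n = 2 * m + 1" by (elim oddE)
    define f where "f = fst (prod_decode m)"
    define ns where "ns = list_decode (snd (prod_decode m))"
    have "m = prod_encode (f, list_encode ns)" by (simp add: f_def ns_def)
    moreover have "i < n" if "i \<in> set ns" for i
      using mem_less_list_encode[OF that] le_prod_encode_2[of "snd (prod_decode m)" "fst (prod_decode m)"] m by (simp add: ns_def)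
    then obtain g where "\<And>i. i \<in> set ns \<Longrightarrow> enc_trm (g i) = i" using less.IH by metis
    then have "map enc_trm (map g ns) = ns" by (simp add: map_idI)
    ultimately have "enc_trm (Fn f (map g ns)) = n" using m by simp
    then show ?thesis ..
  qed
qed

text \<open>Inverses given by choice suffice: computations act on codes, and the decoders serve only
  to state what the codes mean.\<close>

definition dec_trm :: "nat \<Rightarrow> trm" where "dec_trm = inv enc_trm"
definition dec_atm :: "nat \<Rightarrow> atm" where "dec_atm = inv enc_atm"

lemma dec_enc_trm [simp]: "dec_trm (enc_trm t) = t"
  unfolding dec_trm_def by (rule inv_f_f) (simp add: inj_def inj_enc_trm)

lemma enc_dec_trm [simp]: "enc_trm (dec_trm n) = n"
  unfolding dec_trm_def by (rule surj_f_inv_f) (metis surj_def surj_enc_trm)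

lemma inj_enc_atm: "inj enc_atm"
proof (rule injI)
  fix a b
  assume eq: "enc_atm a = enc_atm b"
  obtain p ss q ts where a: "a = Atm p ss" and b: "b = Atm q ts" by (metis atm.exhaust)
  have "p = q" "list_encode (map enc_trm ss) = list_encode (map enc_trm ts)"
    using eq by (simp_all add: a b prod_encode_eq)
  then have "map dec_trm (map enc_trm ss) = map dec_trm (map enc_trm ts)" by (metis list_encode_inverse)
  then show "a = b" using \<open>p = q\<close> by (simp add: a b comp_def)
qed

lemma surj_enc_atm: "surj enc_atm"
proof (rule surjI)
  fix n
  show "enc_atm (Atm (fst (prod_decode n)) (map dec_trm (list_decode (snd (prod_decode n))))) = n"
    by (simp add: comp_def)
qed

lemma dec_enc_atm [simp]: "dec_atm (enc_atm a) = a"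
  unfolding dec_atm_def by (rule inv_f_f[OF inj_enc_atm])

lemma enc_dec_atm [simp]: "enc_atm (dec_atm n) = n"
  unfolding dec_atm_def by (rule surj_f_inv_f[OF surj_enc_atm])

text \<open>Repeated unpairing reads any number as an infinite sequence, so access never fails and
  no length is stored. The index is fixed outside the computation.\<close>

primrec tuple_nth :: "nat \<Rightarrow> nat \<Rightarrow> nat" where
  "tuple_nth 0 s = fst (prod_decode s)"
| "tuple_nth (Suc v) s = tuple_nth v (snd (prod_decode s))"

text \<open>The code of \<open>m\<close> copies of \<open>b\<close> followed by 0. Pairing is
  monotone, so \<open>m\<close> entries up to \<open>b\<close> can be coded by a number up to this
  one.\<close>

primrec tuple_bound :: "nat \<Rightarrow> nat \<Rightarrow> nat" where
  "tuple_bound 0 b = 0"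
| "tuple_bound (Suc m) b = prod_encode (b, tuple_bound m b)"

lemma computable_tuple_nth: "computable F \<Longrightarrow> computable (\<lambda>x. tuple_nth v (F x))"
  by (induction v arbitrary: F) (auto intro: computable_intros)

lemma computable_tuple_bound: "computable F \<Longrightarrow> computable (\<lambda>x. tuple_bound m (F x))"
  by (induction m) (auto intro: computable_intros)

lemma prod_encode_mono: "a \<le> c \<Longrightarrow> b \<le> d \<Longrightarrow> prod_encode (a, b) \<le> prod_encode (c, d)"
proof -
  assume *: "a \<le> c" "b \<le> d"
  have "triangle (a + b) \<le> triangle (c + d)" by (rule triangle_mono) (use * in simp)
  then show ?thesis using * by (simp add: prod_encode_def)
qed

lemma ex_tuple:
  assumes "\<And>v. v < m \<Longrightarrow> f v \<le> b"
  shows "\<exists>s\<le>tuple_bound m b. \<forall>v<m. tuple_nth v s = f v"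
  using assms
proof (induction m arbitrary: f)
  case (Suc m)
  obtain s where s: "s \<le> tuple_bound m b" "\<forall>v<m. tuple_nth v s = f (Suc v)"
    using Suc.IH[of "\<lambda>v. f (Suc v)"] Suc.prems by auto
  have "tuple_nth v (prod_encode (f 0, s)) = f v" if "v < Suc m" for v
    using that s(2) by (cases v) auto
  moreover have "prod_encode (f 0, s) \<le> tuple_bound (Suc m) b"
    using s(1) Suc.prems by (simp add: prod_encode_mono)
  ultimately show ?case by blast
qed simp

definition dec_subst :: "nat \<Rightarrow> subst" where
  "dec_subst s v = dec_trm (tuple_nth v s)"

lemma ex_dec_subst: "\<exists>s. \<forall>v<m. dec_subst s v = \<sigma> v"
proof -
  have "\<exists>b. \<forall>v<m. enc_trm (\<sigma> v) \<le> b"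
    by (rule exI[of _ "Max ((\<lambda>v. enc_trm (\<sigma> v)) ` {..<m})"]) (auto intro: Max_ge)
  then obtain b where "\<forall>v<m. enc_trm (\<sigma> v) \<le> b" ..
  then obtain s where "\<forall>v<m. tuple_nth v s = enc_trm (\<sigma> v)"
    using ex_tuple[of m "\<lambda>v. enc_trm (\<sigma> v)" b] by auto
  then show ?thesis by (intro exI[of _ s]) (simp add: dec_subst_def)
qed

lemma computable_list_encode:
  "(\<And>t. t \<in> set ts \<Longrightarrow> computable (F t)) \<Longrightarrow> computable (\<lambda>x. list_encode (map (\<lambda>t. F t x) ts))"
  by (induction ts) (auto intro!: computable_intros)

text \<open>The term is fixed and only the substitution varies, so the recursion on \<open>t\<close>
  takes place outside the computed function.\<close>

lemma computable_enc_subst_trm: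
  assumes "computable F"
  shows "computable (\<lambda>x. enc_trm (subst_trm (dec_subst (F x)) t))"
proof (induction t)
  case (Var v)
  then show ?case by (simp add: dec_subst_def computable_tuple_nth assms)
next
  case (Fn f ts)
  then show ?case
    by (auto simp: comp_def intro!: computable_intros computable_list_encode)
qed

lemma computable_enc_subst_atm:
  assumes "computable F"
  shows "computable (\<lambda>x. enc_atm (subst_atm (dec_subst (F x)) a))"
  by (cases a) (auto simp: comp_def intro!: computable_intros computable_list_encode computable_enc_subst_trm assms)

text \<open>The source of the search bound: a matching substitution cannot use terms with larger
  codes than the instance it produces.\<close>

lemma enc_trm_subst_le: "x \<in> vars_trm t \<Longrightarrow> enc_trm (\<sigma> x) \<le> enc_trm (subst_trm \<sigma> t)"
proof (induction t)
  case (Fn f ts)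
  then obtain t where t: "t \<in> set ts" "x \<in> vars_trm t" by auto
  have "enc_trm (\<sigma> x) \<le> enc_trm (subst_trm \<sigma> t)" using Fn.IH t by blast
  also have "\<dots> \<le> list_encode (map enc_trm (map (subst_trm \<sigma>) ts))"
    by (rule less_imp_le, rule mem_less_list_encode) (use t in auto)
  also have "\<dots> \<le> enc_trm (subst_trm \<sigma> (Fn f ts))"
    using le_prod_encode_2[of "list_encode (map enc_trm (map (subst_trm \<sigma>) ts))" f] by simp
  finally show ?case .
qed simp

lemma enc_atm_subst_le:
  assumes "x \<in> vars_atm a"
  shows "enc_trm (\<sigma> x) \<le> enc_atm (subst_atm \<sigma> a)"
proof -
  obtain p ts t where a: "a = Atm p ts" "t \<in> set ts" "x \<in> vars_trm t" using assms by (cases a) auto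
  have "enc_trm (\<sigma> x) \<le> enc_trm (subst_trm \<sigma> t)" using a(3) by (rule enc_trm_subst_le)
  also have "\<dots> \<le> list_encode (map enc_trm (map (subst_trm \<sigma>) ts))"
    by (rule less_imp_le, rule mem_less_list_encode) (use a in auto)
  also have "\<dots> \<le> enc_atm (subst_atm \<sigma> a)"
    using le_prod_encode_2[of "list_encode (map enc_trm (map (subst_trm \<sigma>) ts))" p] by (simp add: a)
  finally show ?thesis .
qed

lemma finite_vars_trm: "finite (vars_trm t)"
  by (induction t) auto

lemma finite_vars_atm: "finite (vars_atm a)"
  by (cases a) (auto simp: finite_vars_trm)

lemma finite_syms_trm: "finite (syms_trm t)"
  by (induction t) auto

lemma finite_lang:
  assumes "finite P"
  shows "finite (lang P)"
proof -
  have "finite (syms_atm a)" for a by (cases a) (auto simp: finite_syms_trm)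
  then show ?thesis using assms by (auto simp: lang_def syms_prog_def syms_rule_def)
qed

section \<open>Enumerability of ground counter-supports\<close>

text \<open>The inference rules are the finitely many symbols of the language. Each has a fixed
  arity \<open>n\<close>, so its arguments are read off the first \<open>n\<close> entries of a
  guessed tuple.\<close>

lemma re_in_hu:
  assumes "finite P"
  shows "re (\<lambda>t. in_hu P (dec_trm t))"
proof -
  define St where "St = (\<lambda>t w. \<exists>(f, n)\<in>lang P. \<exists>s.
    t = Suc (2 * prod_encode (f, list_encode (map (\<lambda>i. tuple_nth i s) [0..<n]))) \<and>
    (\<forall>i\<in>{..<n}. tuple_nth i s \<in> set_decode w))"
  have "re (derivable St)"
    unfolding St_def
    by (intro re_derivable re_finite_ex finite_lang assms)
      (auto intro!: re_ex re_conj re_eq re_finite_all re_mem_set_decode computable_intros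
        computable_list_encode computable_tuple_nth)
  moreover have "in_hu P (dec_trm t) \<longleftrightarrow> derivable St t" for t
  proof
    have "derivable St (enc_trm t)" if "in_hu P t" for t
      using that
    proof (induction t)
      case (Var x)
      then show ?case by (simp add: in_hu_def)
    next
      case (Fn f ts)
      then have lang: "(f, length ts) \<in> lang P" and IH: "\<And>t. t \<in> set ts \<Longrightarrow> derivable St (enc_trm t)"
        by (auto simp: in_hu_Fn)
      obtain s where "\<forall>i<length ts. dec_subst s i = ts ! i" using ex_dec_subst[of "length ts" "\<lambda>i. ts ! i"] by blast
      then have s: "tuple_nth i s = enc_trm (ts ! i)" if "i < length ts" for i
        using that by (metis dec_subst_def enc_dec_trm)
      have "map (\<lambda>i. tuple_nth i s) [0..<length ts] = map enc_trm ts"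
        by (rule nth_equalityI) (auto simp: s)
      moreover have w: "set_decode (set_encode (enc_trm ` set ts)) = enc_trm ` set ts"
        by (simp add: set_encode_inverse)
      ultimately have "St (enc_trm (Fn f ts)) (set_encode (enc_trm ` set ts))"
        unfolding St_def using lang s by (auto intro!: bexI[of _ "(f, length ts)"] exI[of _ s])
      then show ?case by (rule derivable.intros) (use IH w in auto)
    qed
    then show "derivable St t" if "in_hu P (dec_trm t)" using that by (metis enc_dec_trm)
    show "in_hu P (dec_trm t)" if "derivable St t"
      using that
    proof induction
      case (1 t w)
      then obtain f n s where *: "(f, n) \<in> lang P" "\<forall>i\<in>{..<n}. tuple_nth i s \<in> set_decode w"
        "t = Suc (2 * prod_encode (f, list_encode (map (\<lambda>i. tuple_nth i s) [0..<n])))"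
        unfolding St_def by auto
      have "t = enc_trm (Fn f (map (\<lambda>i. dec_trm (tuple_nth i s)) [0..<n]))"
        using *(3) by (simp add: comp_def)
      then have "dec_trm t = Fn f (map (\<lambda>i. dec_trm (tuple_nth i s)) [0..<n])"
        by (simp only: dec_enc_trm)
      then show ?case using * "1.IH" by (auto simp: in_hu_Fn)
    qed
  qed
  ultimately show ?thesis by simp
qed

lemma rule_vars_bound:
  assumes "finite P"
  obtains m where "\<forall>(h, b)\<in>P. \<forall>x\<in>vars_atm h. x < m"
proof -
  have "finite (\<Union>r\<in>P. vars_atm (fst r))" using assms finite_vars_atm by blast
  then obtain m where "\<forall>x\<in>(\<Union>r\<in>P. vars_atm (fst r)). x < m" using finite_nat_set_iff_bounded by auto
  then show ?thesis using that[of m] by force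
qed

lemma instances_coded:
  assumes "safe P" and "\<forall>(h, b)\<in>P. \<forall>x\<in>vars_atm h. x < m"
  shows "(A, b) \<in> instances P \<longleftrightarrow> (\<exists>r\<in>P. \<exists>s\<le>tuple_bound m (enc_atm A).
    enc_atm A = enc_atm (subst_atm (dec_subst s) (fst r)) \<and> b = map (subst_lit (dec_subst s)) (snd r))"
proof
  assume "(A, b) \<in> instances P"
  then obtain \<sigma> h b' where *: "A = subst_atm \<sigma> h" "b = map (subst_lit \<sigma>) b'" "(h, b') \<in> P"
    unfolding instances_def by blast
  \<comment> \<open>At variables outside the head \<open>\<sigma>\<close> may take arbitrarily large
    values. Entry 0 is used there to respect the bound, and safety keeps these variables out of the
    body.\<close>
  have "(if v \<in> vars_atm h then enc_trm (\<sigma> v) else 0) \<le> enc_atm A" for v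
    using enc_atm_subst_le *(1) by simp
  then obtain s where s: "s \<le> tuple_bound m (enc_atm A)"
    "\<forall>v<m. tuple_nth v s = (if v \<in> vars_atm h then enc_trm (\<sigma> v) else 0)"
    using ex_tuple[of m "\<lambda>v. if v \<in> vars_atm h then enc_trm (\<sigma> v) else 0"] by blast
  then have eq: "dec_subst s v = \<sigma> v" if "v \<in> vars_atm h" for v
    using that assms(2) *(3) s(2) by (auto simp: dec_subst_def)
  have "A = subst_atm (dec_subst s) h" by (simp add: *(1) subst_atm_eq_iff eq)
  moreover have "b = map (subst_lit (dec_subst s)) b'"
    using safeD[OF assms(1) *(3)] eq by (auto simp: *(2) intro!: subst_lit_cong)
  ultimately show "\<exists>r\<in>P. \<exists>s\<le>tuple_bound m (enc_atm A).
    enc_atm A = enc_atm (subst_atm (dec_subst s) (fst r)) \<and> b = map (subst_lit (dec_subst s)) (snd r)"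
    using *(3) s(1) by (intro bexI[of _ "(h, b')"] exI[of _ s]) simp_all
next
  assume "\<exists>r\<in>P. \<exists>s\<le>tuple_bound m (enc_atm A).
    enc_atm A = enc_atm (subst_atm (dec_subst s) (fst r)) \<and> b = map (subst_lit (dec_subst s)) (snd r)"
  then show "(A, b) \<in> instances P"
    using inj_enc_atm unfolding instances_def by (auto dest!: injD) blast
qed

section \<open>Quantifiers over rule instances\<close>

lemma re_ex_instance:
  assumes "finite P" and "safe P" and "computable F"
    and "\<And>b. re (\<lambda>z. C (map (subst_lit (dec_subst (fst (prod_decode z)))) b) (snd (prod_decode z)))"
  shows "re (\<lambda>x. \<exists>b. (dec_atm (F x), b) \<in> instances P \<and> C b x)"
proof -
  obtain m where m: "\<forall>(h, b)\<in>P. \<forall>x\<in>vars_atm h. x < m"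
    using rule_vars_bound[OF assms(1)] by blast
  have swap_ex: "(\<exists>b. (\<exists>r\<in>P. \<exists>s\<le>n. E s r \<and> b = g s r) \<and> D b) \<longleftrightarrow>
      (\<exists>s\<le>n. \<exists>r\<in>P. E s r \<and> D (g s r))" for n :: nat and E D and g :: "nat \<Rightarrow> rule \<Rightarrow> lit list"
    by blast
  have "re (\<lambda>x. \<exists>s. s < Suc (tuple_bound m (F x)) \<and> (\<exists>r\<in>P. F x = enc_atm (subst_atm (dec_subst s) (fst r)) \<and>
      C (map (subst_lit (dec_subst s)) (snd r)) x))"
    by (intro re_ex re_finite_ex assms re_conj re_eq re_decidable[OF decidable_less] computable_Suc computable_tuple_bound
        computable_enc_subst_atm computable_compose[OF assms(3)] computable_intros)
  moreover have "(\<exists>b. (dec_atm (F x), b) \<in> instances P \<and> C b x) \<longleftrightarrow>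
      (\<exists>s. s < Suc (tuple_bound m (F x)) \<and> (\<exists>r\<in>P. F x = enc_atm (subst_atm (dec_subst s) (fst r)) \<and>
      C (map (subst_lit (dec_subst s)) (snd r)) x))" for x
    unfolding instances_coded[OF assms(2) m] less_Suc_eq_le enc_dec_atm by (rule swap_ex)
  ultimately show ?thesis by (simp only:)
qed

text \<open>The bound on the substitution code pays off here: a bounded universal quantifier
  preserves recursive enumerability, and the premise that the heads match is decidable.\<close>

lemma re_all_instances:
  assumes "finite P" and "safe P" and "computable F"
    and "\<And>b. re (\<lambda>z. C (map (subst_lit (dec_subst (fst (prod_decode z)))) b) (snd (prod_decode z)))"
  shows "re (\<lambda>x. \<forall>b. (dec_atm (F x), b) \<in> instances P \<longrightarrow> C b x)"
proof -
  obtain m where m: "\<forall>(h, b)\<in>P. \<forall>x\<in>vars_atm h. x < m"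
    using rule_vars_bound[OF assms(1)] by blast
  have swap_all: "(\<forall>b. (\<exists>r\<in>P. \<exists>s\<le>n. E s r \<and> b = g s r) \<longrightarrow> D b) \<longleftrightarrow>
      (\<forall>s\<le>n. \<forall>r\<in>P. \<not> E s r \<or> D (g s r))" for n :: nat and E D and g :: "nat \<Rightarrow> rule \<Rightarrow> lit list"
    by blast
  have "re (\<lambda>x. \<forall>s<Suc (tuple_bound m (F x)). \<forall>r\<in>P. F x \<noteq> enc_atm (subst_atm (dec_subst s) (fst r)) \<or>
      C (map (subst_lit (dec_subst s)) (snd r)) x)"
    by (intro re_bounded_all re_finite_all assms re_disj re_decidable[OF decidable_not[OF decidable_eq]]
        computable_Suc computable_tuple_bound
        computable_enc_subst_atm computable_compose[OF assms(3)] computable_intros)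
  moreover have "(\<forall>b. (dec_atm (F x), b) \<in> instances P \<longrightarrow> C b x) \<longleftrightarrow>
      (\<forall>s<Suc (tuple_bound m (F x)). \<forall>r\<in>P. F x \<noteq> enc_atm (subst_atm (dec_subst s) (fst r)) \<or>
      C (map (subst_lit (dec_subst s)) (snd r)) x)" for x
    unfolding instances_coded[OF assms(2) m] less_Suc_eq_le enc_dec_atm by (rule swap_all)
  ultimately show ?thesis by (simp only:)
qed

text \<open>A substitution keeps the sign of a literal, so for fixed \<open>L\<close> the case
  distinction is settled before anything is computed.\<close>

lemma re_literal:
  assumes "re (\<lambda>z. U (fst (prod_decode z)) (snd (prod_decode z)))"
    and "re (\<lambda>z. V (fst (prod_decode z)) (snd (prod_decode z)))"
  shows "re (\<lambda>z. case subst_lit (dec_subst (fst (prod_decode z))) L of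
    Pos D \<Rightarrow> U (enc_atm D) (snd (prod_decode z)) | Neg D \<Rightarrow> V (enc_atm D) (snd (prod_decode z)))"
  by (cases L) (auto intro!: re_compose2[OF assms(1)] re_compose2[OF assms(2)]
      computable_enc_subst_atm computable_intros)

lemma re_ball_literal:
  assumes "re (\<lambda>z. U (fst (prod_decode z)) (snd (prod_decode z)))"
    and "re (\<lambda>z. V (fst (prod_decode z)) (snd (prod_decode z)))"
  shows "re (\<lambda>z. \<forall>L\<in>set (map (subst_lit (dec_subst (fst (prod_decode z)))) b).
    case L of Pos D \<Rightarrow> U (enc_atm D) (snd (prod_decode z)) | Neg D \<Rightarrow> V (enc_atm D) (snd (prod_decode z)))"
  unfolding set_map ball_simps by (intro re_finite_all re_literal assms finite_set)

lemma re_bex_literal: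
  assumes "re (\<lambda>z. U (fst (prod_decode z)) (snd (prod_decode z)))"
    and "re (\<lambda>z. V (fst (prod_decode z)) (snd (prod_decode z)))"
  shows "re (\<lambda>z. \<exists>L\<in>set (map (subst_lit (dec_subst (fst (prod_decode z)))) b).
    case L of Pos D \<Rightarrow> U (enc_atm D) (snd (prod_decode z)) | Neg D \<Rightarrow> V (enc_atm D) (snd (prod_decode z)))"
  unfolding set_map bex_simps by (intro re_finite_ex re_literal assms finite_set)

text \<open>Negative literals are never resolved, so an atom has a support iff it follows from the
  rules after all negative literals are deleted. Each rule instance is then an inference
  step.\<close>

lemma re_supported:
  assumes "finite P" and "safe P"
  shows "re (\<lambda>x. \<exists>S. goal_support (instances P) [Pos (dec_atm x)] S)"
proof -
  define St where "St = (\<lambda>x w. \<exists>b. (dec_atm x, b) \<in> instances P \<and>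
    (\<forall>L\<in>set b. case L of Pos D \<Rightarrow> enc_atm D \<in> set_decode w | Neg D \<Rightarrow> True))"
  have "re (derivable St)"
    unfolding St_def
    by (intro re_derivable re_ex_instance assms re_ball_literal re_mem_set_decode re_True computable_intros)
  moreover have "(\<exists>S. goal_support (instances P) [Pos (dec_atm x)] S) \<longleftrightarrow> derivable St x" for x
  proof
    have "\<forall>A. Pos A \<in> set G \<longrightarrow> derivable St (enc_atm A)" if "goal_support (instances P) G S" for G S
      using that
    proof induction
      case (Pos A b S G T)
      have w: "set_decode (set_encode (enc_atm ` {D. Pos D \<in> set b})) = enc_atm ` {D. Pos D \<in> set b}"
      proof (rule set_encode_inverse)
        have "{D. Pos D \<in> set b} \<subseteq> lit_atm ` set b" by force
        then show "finite (enc_atm ` {D. Pos D \<in> set b})" using finite_subset by blast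
      qed
      have "St (enc_atm A) (set_encode (enc_atm ` {D. Pos D \<in> set b}))"
        unfolding St_def w using Pos.hyps(1) by (auto intro!: exI[of _ b] split: lit.split)
      then have "derivable St (enc_atm A)"
        by (rule derivable.intros) (use w Pos.IH in auto)
      then show ?case using Pos.IH by auto
    qed auto
    then show "derivable St x" if "\<exists>S. goal_support (instances P) [Pos (dec_atm x)] S"
      using that by (metis enc_dec_atm list.set_intros(1))
    show "\<exists>S. goal_support (instances P) [Pos (dec_atm x)] S" if "derivable St x"
      using that
    proof induction
      case (1 x w)
      then obtain b where b: "(dec_atm x, b) \<in> instances P" "\<And>D. Pos D \<in> set b \<Longrightarrow> enc_atm D \<in> set_decode w"
        unfolding St_def by force
      then have "\<forall>D. Pos D \<in> set b \<longrightarrow> (\<exists>S. goal_support (instances P) [Pos D] S)"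
        using "1.IH" by (metis dec_enc_atm)
      then obtain f where "\<And>D. Pos D \<in> set b \<Longrightarrow> goal_support (instances P) [Pos D] (f D)" by metis
      from goal_supportI[of b, OF this] show ?case using b(1) by (auto simp: goal_support_Pos_iff)
    qed
  qed
  ultimately show ?thesis by simp
qed

text \<open>The pair is (\<open>B\<close>, head). One body literal \<open>L\<close> must contribute
  \<open>B\<close>, while the other positive ones only need some support; hence the previous lemma
  is used in the side condition.\<close>

lemma re_in_some_support:
  assumes "finite P" and "safe P"
  shows "re (\<lambda>z. \<exists>S. goal_support (instances P) [Pos (dec_atm (snd (prod_decode z)))] S \<and>
    dec_atm (fst (prod_decode z)) \<in> S)"
proof -
  let ?R = "instances P"
  define supported where "supported = (\<lambda>x. \<exists>S. goal_support ?R [Pos (dec_atm x)] S)"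
  define St where "St = (\<lambda>z w. \<exists>b. (dec_atm (snd (prod_decode z)), b) \<in> ?R \<and>
    (\<forall>L\<in>set b. case L of Pos D \<Rightarrow> supported (enc_atm D) | Neg D \<Rightarrow> True) \<and>
    (\<exists>L\<in>set b. case L of Pos D \<Rightarrow> prod_encode (fst (prod_decode z), enc_atm D) \<in> set_decode w
       | Neg D \<Rightarrow> enc_atm D = fst (prod_decode z)))"
  have supported: "re supported" unfolding supported_def by (rule re_supported[OF assms])
  have "re (derivable St)"
    unfolding St_def
    by (intro re_derivable re_ex_instance assms re_conj re_ball_literal re_bex_literal re_mem_set_decode re_True
        re_eq re_compose[OF supported] computable_intros)
  moreover have "(\<exists>S. goal_support ?R [Pos (dec_atm (snd (prod_decode z)))] S \<and>
    dec_atm (fst (prod_decode z)) \<in> S) \<longleftrightarrow> derivable St z" for z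
  proof
    have "\<exists>L\<in>set G. case L of Pos A \<Rightarrow> derivable St (prod_encode (enc_atm B, enc_atm A)) | Neg A \<Rightarrow> A = B"
      if "goal_support ?R G S" "B \<in> S" for G S B
      using that
    proof induction
      case (Pos A b S G T)
      show ?case
      proof (cases "B \<in> S")
        case True
        then obtain L where L: "L \<in> set b"
          "case L of Pos A \<Rightarrow> derivable St (prod_encode (enc_atm B, enc_atm A)) | Neg A \<Rightarrow> A = B"
          using Pos.IH by blast
        \<comment> \<open>A positive \<open>L\<close> is the only premise; a negative one already
          equals \<open>Neg B\<close> and leaves an axiom.\<close>
        define w :: nat where "w = (case L of Pos A \<Rightarrow> 2 ^ prod_encode (enc_atm B, enc_atm A) | Neg A \<Rightarrow> 0)"
        have "supported (enc_atm D)" if "Pos D \<in> set b" for D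
          using goal_support_literal(2)[OF Pos.hyps(2) that] by (auto simp: supported_def)
        then have "St (prod_encode (enc_atm B, enc_atm A)) w"
          unfolding St_def using Pos.hyps(1) L
          by (intro exI[of _ b]) (auto simp: w_def set_decode_power_2 split: lit.splits intro!: bexI[of _ L])
        then have "derivable St (prod_encode (enc_atm B, enc_atm A))"
          by (rule derivable.intros) (use L(2) in \<open>auto simp: w_def set_decode_power_2 split: lit.splits\<close>)
        then show ?thesis by simp
      next
        case False
        then show ?thesis using Pos by auto
      qed
    qed auto
    from this[of "[Pos (dec_atm (snd (prod_decode z)))]" _ "dec_atm (fst (prod_decode z))"]
    show "derivable St z" if "\<exists>S. goal_support ?R [Pos (dec_atm (snd (prod_decode z)))] S \<and>
      dec_atm (fst (prod_decode z)) \<in> S"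
      using that by auto
    show "\<exists>S. goal_support ?R [Pos (dec_atm (snd (prod_decode z)))] S \<and> dec_atm (fst (prod_decode z)) \<in> S"
      if "derivable St z"
      using that
    proof induction
      case (1 z w)
      then obtain b L where b: "(dec_atm (snd (prod_decode z)), b) \<in> ?R"
        "\<And>D. Pos D \<in> set b \<Longrightarrow> supported (enc_atm D)" and L: "L \<in> set b"
        "case L of Pos D \<Rightarrow> prod_encode (fst (prod_decode z), enc_atm D) \<in> set_decode w
          | Neg D \<Rightarrow> enc_atm D = fst (prod_decode z)"
        unfolding St_def by force
      define B where "B = dec_atm (fst (prod_decode z))"
      have "\<exists>S. goal_support ?R [Pos D] S \<and> (L = Pos D \<longrightarrow> B \<in> S)" if "Pos D \<in> set b" for D
      proof (cases "L = Pos D")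
        case True
        then show ?thesis using "1.IH"[of "prod_encode (fst (prod_decode z), enc_atm D)"] L(2) by (simp add: B_def)
      next
        case False
        then show ?thesis using b(2)[OF that] by (auto simp: supported_def)
      qed
      then obtain f where f: "\<And>D. Pos D \<in> set b \<Longrightarrow> goal_support ?R [Pos D] (f D) \<and> (L = Pos D \<longrightarrow> B \<in> f D)"
        by metis
      let ?S = "{B. Neg B \<in> set b} \<union> (\<Union>D\<in>{D. Pos D \<in> set b}. f D)"
      have "goal_support ?R b ?S" using f by (intro goal_supportI) blast
      then have "goal_support ?R [Pos (dec_atm (snd (prod_decode z)))] ?S"
        using b(1) by (auto simp: goal_support_Pos_iff)
      moreover have "B \<in> ?S"
      proof (cases L)
        case (Pos D)
        then show ?thesis using f L(1) by auto
      next
        case (Neg D)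
        then have "enc_atm D = fst (prod_decode z)" using L(2) by simp
        then have "D = B" unfolding B_def by (metis dec_enc_atm)
        then show ?thesis using L(1) Neg by auto
      qed
      ultimately show ?case unfolding B_def by blast
    qed
  qed
  ultimately show ?thesis by simp
qed

text \<open>\<open>N\<close> is guessed as a set code, whose elements can be searched exhaustively.
  \<open>K\<close> comes as a list code because that is how \<open>enc_cs\<close> presents
  it.\<close>

lemma re_blocked:
  assumes "finite P" and "safe P"
  shows "re (\<lambda>z. \<exists>N. finite N \<and> dec_atm (fst (prod_decode z)) \<in> N \<and>
    blocked (instances P) (dec_atm ` set (list_decode (snd (prod_decode z)))) N)"
proof -
  have "re (\<lambda>z. \<exists>w. fst (prod_decode z) \<in> set_decode w \<and> (\<forall>a\<in>set_decode w.
    \<forall>b. (dec_atm a, b) \<in> instances P \<longrightarrow> (\<exists>L\<in>set b. case L of Pos D \<Rightarrow> enc_atm D \<in> set_decode w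
      | Neg D \<Rightarrow> enc_atm D \<in> set (list_decode (snd (prod_decode z))))))"
    by (intro re_ex re_conj re_ball_set_decode re_all_instances assms re_bex_literal
        re_mem_set_decode re_mem_list computable_intros)
  moreover have "(\<exists>N. finite N \<and> A \<in> N \<and> blocked R (dec_atm ` K) N) \<longleftrightarrow>
    (\<exists>w. enc_atm A \<in> set_decode w \<and> (\<forall>a\<in>set_decode w. \<forall>b. (dec_atm a, b) \<in> R \<longrightarrow>
      (\<exists>L\<in>set b. case L of Pos D \<Rightarrow> enc_atm D \<in> set_decode w | Neg D \<Rightarrow> enc_atm D \<in> K)))" for A R K
  proof -
    have mem: "D \<in> dec_atm ` M \<longleftrightarrow> enc_atm D \<in> M" for D M
      by (metis dec_enc_atm enc_dec_atm image_iff)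
    have blocked: "blocked R (dec_atm ` K) (dec_atm ` M) \<longleftrightarrow> (\<forall>a\<in>M. \<forall>b. (dec_atm a, b) \<in> R \<longrightarrow>
      (\<exists>L\<in>set b. case L of Pos D \<Rightarrow> enc_atm D \<in> M | Neg D \<Rightarrow> enc_atm D \<in> K))" for M
      unfolding blocked_def mem by (metis dec_enc_atm enc_dec_atm)
    have "(\<exists>N. finite N \<and> A \<in> N \<and> blocked R (dec_atm ` K) N) \<longleftrightarrow>
      (\<exists>w. A \<in> dec_atm ` set_decode w \<and> blocked R (dec_atm ` K) (dec_atm ` set_decode w))"
    proof
      assume "\<exists>N. finite N \<and> A \<in> N \<and> blocked R (dec_atm ` K) N"
      then obtain N where N: "finite N" "A \<in> N" "blocked R (dec_atm ` K) N" by blast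
      have "N = dec_atm ` set_decode (set_encode (enc_atm ` N))"
        using N(1) by (simp add: set_encode_inverse image_image)
      then show "\<exists>w. A \<in> dec_atm ` set_decode w \<and> blocked R (dec_atm ` K) (dec_atm ` set_decode w)"
        using N by metis
    next
      assume "\<exists>w. A \<in> dec_atm ` set_decode w \<and> blocked R (dec_atm ` K) (dec_atm ` set_decode w)"
      then show "\<exists>N. finite N \<and> A \<in> N \<and> blocked R (dec_atm ` K) N" by (meson finite_imageI finite_set_decode)
    qed
    then show ?thesis unfolding blocked mem .
  qed
  ultimately show ?thesis by simp
qed

lemma re_ground_counter_support:
  assumes "finite P" and "finitely_recursive P" and "safe P"
  shows "re (\<lambda>z. (\<exists>N. finite N \<and> dec_atm (fst (prod_decode z)) \<in> N \<and>
      blocked (instances P) (dec_atm ` set (list_decode (snd (prod_decode z)))) N) \<and>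
    (\<forall>B\<in>dec_atm ` set (list_decode (snd (prod_decode z))).
      \<exists>S. goal_support (instances P) [Pos (dec_atm (fst (prod_decode z)))] S \<and> B \<in> S))"
proof -
  have in_support: "re (\<lambda>z. \<exists>S. goal_support (instances P) [Pos (dec_atm (G z))] S \<and> dec_atm (F z) \<in> S)"
    if "computable F" "computable G" for F G
    by (rule re_compose2[of "\<lambda>b a. \<exists>S. goal_support (instances P) [Pos (dec_atm a)] S \<and> dec_atm b \<in> S"])
      (use that re_in_some_support[OF assms(1,3)] in auto)
  show ?thesis
    unfolding ball_simps
    by (intro re_conj re_blocked assms re_ball_list in_support computable_intros)
qed

section \<open>A complete counter-support function\<close>

text \<open>A grounding substitution binds infinitely many variables and has no finite code.
  Restricting it to \<open>A\<close>, in increasing order of variables, gives a canonical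
  association list as required by \<open>re_cs_set\<close>.\<close>

definition ground_subst :: "atm \<Rightarrow> subst \<Rightarrow> subst" where
  "ground_subst A \<gamma> = subst_of (map (\<lambda>x. (x, \<gamma> x)) (sorted_list_of_set (vars_atm A)))"

definition ground_CS :: "rule set \<Rightarrow> atm \<Rightarrow> (atm set \<times> subst) set" where
  "ground_CS P A = {(K, ground_subst A \<gamma>) | \<gamma> K.
     grounding P \<gamma> \<and> ground_counter_support P (subst_atm \<gamma> A) K}"

lemma set_sorted_vars: "set (sorted_list_of_set (vars_atm A)) = vars_atm A"
  by (simp add: finite_vars_atm)

lemma ground_subst_apply: "x \<in> vars_atm A \<Longrightarrow> ground_subst A \<gamma> x = \<gamma> x"
  by (simp add: ground_subst_def subst_of_def map_of_map_keys set_sorted_vars map_of_map_restrict)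

lemma subst_ground_subst: "subst_atm (ground_subst A \<gamma>) A = subst_atm \<gamma> A"
  by (simp add: subst_atm_eq_iff ground_subst_apply)

lemma subst_atm_grounding:
  assumes "grounding P \<gamma>"
  shows "subst_atm \<sigma> (subst_atm \<gamma> A) = subst_atm \<gamma> A"
proof -
  have "subst_trm \<sigma> (subst_trm \<gamma> t) = subst_trm \<gamma> t" for t
  proof (induction t)
    case (Var x)
    have "vars_trm (\<gamma> x) = {}" using assms by (simp add: grounding_def in_hu_def)
    then have "subst_trm \<sigma> (\<gamma> x) = subst_trm Var (\<gamma> x)" by (simp add: subst_trm_eq_iff)
    then show ?case by (simp add: subst_trm_Var)
  qed simp
  then show ?thesis by (cases A) simp
qed

lemma subst_ground_counter_support: "ground_counter_support P A K \<Longrightarrow> subst_atm \<sigma> ` K = K"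
  by (auto simp: ground_counter_support_def subst_atm_in_hb[of P] intro: rev_image_eqI)

text \<open>Both \<open>K\<close> and the instance of \<open>A\<close> are ground, so each further
  substitution leaves them fixed and a ground counter-support is already a generalized one.\<close>

lemma is_CounterSupp_ground_CS:
  assumes "finitely_recursive P"
  shows "is_CounterSupp P (ground_CS P)"
  using finite_ground_counter_support(2)[OF assms]
  by (auto simp: is_CounterSupp_def ground_CS_def gen_counter_support_def subst_ground_subst
      subst_atm_grounding[of P] subst_ground_counter_support[of P])

lemma complete_CounterSupp_ground_CS: "complete_CounterSupp P (ground_CS P)"
  unfolding complete_CounterSupp_def
proof (intro allI impI)
  fix A \<gamma> K
  assume *: "grounding P \<gamma>" "ground_counter_support P (subst_atm \<gamma> A) K"
  then have "(K, ground_subst A \<gamma>) \<in> ground_CS P A" by (auto simp: ground_CS_def)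
  moreover have "subst_atm \<gamma> (subst_atm (ground_subst A \<gamma>) A) = subst_atm \<gamma> A"
    using *(1) by (simp add: subst_ground_subst subst_atm_grounding[of P])
  moreover have "subst_atm \<gamma> ` K = K" using *(2) by (rule subst_ground_counter_support)
  ultimately show "\<exists>Kt\<in>ground_CS P A. \<exists>\<sigma>. subst_atm \<sigma> (subst_atm (snd Kt) A) = subst_atm \<gamma> A \<and>
      subst_atm \<sigma> ` fst Kt = K"
    by (intro bexI[of _ "(K, ground_subst A \<gamma>)"]) auto
qed

lemma enc_cs_eq_iff: "enc_cs ks bs = enc_cs ks' bs' \<longleftrightarrow> ks = ks' \<and> bs = bs'"
proof -
  have "inj enc_atm" by (rule inj_enc_atm)
  moreover have "inj (\<lambda>(x, t). prod_encode (x, enc_trm t))"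
    by (auto simp: inj_def prod_encode_eq dest: inj_enc_trm)
  ultimately show ?thesis
    unfolding enc_cs_def prod_encode_eq prod.inject
    by (metis inj_map_eq_map list_encode_inverse)
qed

text \<open>\<open>Q\<close> has to be correct only where \<open>s\<close> sends the variables of
  \<open>A\<close> into the Herbrand universe, since that is tested separately.\<close>

lemma re_cs_set_ground_CSI:
  assumes "finite P" and "finitely_recursive P"
    and "re (\<lambda>z. Q (fst (prod_decode z)) (snd (prod_decode z)))"
    and "\<And>s ks. \<forall>x\<in>vars_atm A. in_hu P (dec_subst s x) \<Longrightarrow>
      Q s (list_encode (map enc_atm ks)) \<longleftrightarrow> ground_counter_support P (subst_atm (dec_subst s) A) (set ks)"
  shows "re_cs_set (ground_CS P A)"
proof -
  let ?xs = "sorted_list_of_set (vars_atm A)"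
  let ?bs = "\<lambda>\<gamma> :: subst. map (\<lambda>x. (x, \<gamma> x)) ?xs"
  \<comment> \<open>The second component is built from the guessed \<open>s\<close>, so no coded
    association list has to be parsed. Every list enumerating \<open>K\<close> is accepted, whatever
    its order or repetitions.\<close>
  define R where "R = (\<lambda>z. \<exists>s l. z = prod_encode (l, list_encode (map (\<lambda>x. prod_encode (x, tuple_nth x s)) ?xs)) \<and>
    (\<forall>x\<in>vars_atm A. in_hu P (dec_trm (tuple_nth x s))) \<and> Q s l)"
  have "re R"
    unfolding R_def
    by (intro re_ex re_conj re_eq re_finite_all finite_vars_atm re_compose[OF re_in_hu[OF assms(1)]]
        re_compose2[OF assms(3)] computable_intros computable_list_encode computable_tuple_nth)
  then have re: "re_nat {z. R z}" by (rule re_nat_re)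
  have R: "R (enc_cs ks bs) \<longleftrightarrow> (\<exists>s. bs = ?bs (dec_subst s) \<and> (\<forall>x\<in>vars_atm A. in_hu P (dec_subst s x)) \<and>
    ground_counter_support P (subst_atm (dec_subst s) A) (set ks))" for ks bs
  proof -
    have code: "enc_cs ks' (?bs (dec_subst s)) =
        prod_encode (list_encode (map enc_atm ks'), list_encode (map (\<lambda>x. prod_encode (x, tuple_nth x s)) ?xs))" for s ks'
      by (simp add: enc_cs_def dec_subst_def comp_def)
    have "R (enc_cs ks bs) \<longleftrightarrow> (\<exists>s l. enc_cs ks bs = prod_encode (l, list_encode (map (\<lambda>x. prod_encode (x, tuple_nth x s)) ?xs)) \<and>
      (\<forall>x\<in>vars_atm A. in_hu P (dec_subst s x)) \<and> Q s l)"
      unfolding R_def dec_subst_def ..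
    also have "\<dots> \<longleftrightarrow> (\<exists>s ks'. enc_cs ks bs = enc_cs ks' (?bs (dec_subst s)) \<and>
      (\<forall>x\<in>vars_atm A. in_hu P (dec_subst s x)) \<and> Q s (list_encode (map enc_atm ks')))"
    proof -
      have "l = list_encode (map enc_atm (map dec_atm (list_decode l)))" for l
        by (simp add: comp_def)
      then have "(\<exists>l. X l) \<longleftrightarrow> (\<exists>ks'. X (list_encode (map enc_atm ks')))" for X :: "nat \<Rightarrow> bool"
        by metis
      then show ?thesis unfolding code by (rule iff_exI)
    qed
    also have "\<dots> \<longleftrightarrow> (\<exists>s. bs = ?bs (dec_subst s) \<and> (\<forall>x\<in>vars_atm A. in_hu P (dec_subst s x)) \<and>
      ground_counter_support P (subst_atm (dec_subst s) A) (set ks))"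
      unfolding enc_cs_eq_iff using assms(4) by blast
    finally show ?thesis .
  qed
  obtain c where c: "in_hu P c" using ex_in_hu by blast
  have "ground_CS P A = {(set ks, subst_of bs) | ks bs. enc_cs ks bs \<in> {z. R z}}"
  proof (intro set_eqI iffI)
    fix Kt
    assume "Kt \<in> ground_CS P A"
    then obtain \<gamma> K where Kt: "Kt = (K, ground_subst A \<gamma>)" "grounding P \<gamma>"
      "ground_counter_support P (subst_atm \<gamma> A) K" by (auto simp: ground_CS_def)
    obtain ks where ks: "set ks = K"
      using finite_list finite_ground_counter_support(2)[OF assms(2) Kt(3)] by blast
    obtain m where "\<forall>x\<in>vars_atm A. x < m" using finite_vars_atm finite_nat_set_iff_bounded by blast
    moreover obtain s where "\<forall>x<m. dec_subst s x = \<gamma> x" using ex_dec_subst by blast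
    ultimately have s: "\<And>x. x \<in> vars_atm A \<Longrightarrow> dec_subst s x = \<gamma> x" by blast
    have "?bs \<gamma> = ?bs (dec_subst s)" using s by (simp add: set_sorted_vars)
    moreover have "subst_atm (dec_subst s) A = subst_atm \<gamma> A" using s by (simp add: subst_atm_eq_iff)
    ultimately have "R (enc_cs ks (?bs \<gamma>))"
      unfolding R using Kt(2,3) s ks by (intro exI[of _ s]) (auto simp: grounding_def)
    then show "Kt \<in> {(set ks, subst_of bs) | ks bs. enc_cs ks bs \<in> {z. R z}}"
      using Kt(1) ks unfolding ground_subst_def by blast
  next
    fix Kt
    assume "Kt \<in> {(set ks, subst_of bs) | ks bs. enc_cs ks bs \<in> {z. R z}}"
    then obtain ks s where *: "Kt = (set ks, subst_of (?bs (dec_subst s)))"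
      "\<forall>x\<in>vars_atm A. in_hu P (dec_subst s x)"
      "ground_counter_support P (subst_atm (dec_subst s) A) (set ks)"
      using R by auto
    \<comment> \<open>The guess is controlled only on the variables of \<open>A\<close>; the default
      \<open>c\<close> makes it grounding and is invisible to \<open>ground_subst\<close>.\<close>
    define \<gamma> where "\<gamma> = (\<lambda>x. if x \<in> vars_atm A then dec_subst s x else c)"
    have "?bs (dec_subst s) = ?bs \<gamma>" by (simp add: set_sorted_vars \<gamma>_def)
    then have "Kt = (set ks, ground_subst A \<gamma>)" by (simp only: *(1) ground_subst_def)
    moreover have "grounding P \<gamma>" using *(2) c by (simp add: grounding_def \<gamma>_def)
    moreover have "subst_atm (dec_subst s) A = subst_atm \<gamma> A" by (simp add: subst_atm_eq_iff \<gamma>_def)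
    ultimately show "Kt \<in> ground_CS P A"
      using *(3) unfolding ground_CS_def by auto
  qed
  then show ?thesis using re unfolding re_cs_set_def by blast
qed

lemma re_cs_set_finite:
  assumes "finite X" and "\<And>Kt. Kt \<in> X \<Longrightarrow> \<exists>ks bs. Kt = (set ks, subst_of bs)"
  shows "re_cs_set X"
proof -
  obtain f g where fg: "\<And>Kt. Kt \<in> X \<Longrightarrow> Kt = (set (f Kt), subst_of (g Kt))" using assms(2) by metis
  let ?C = "{z. \<exists>Kt\<in>X. z = enc_cs (f Kt) (g Kt)}"
  have "re_nat ?C"
    by (intro re_nat_re re_finite_ex assms(1) re_eq computable_intros)
  moreover have "X = {(set ks, subst_of bs) | ks bs. enc_cs ks bs \<in> ?C}"
    using fg by (auto simp: enc_cs_eq_iff) blast+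
  ultimately show ?thesis unfolding re_cs_set_def by blast
qed

lemma finite_ground_CS:
  assumes "finitely_recursive P" and "finite {t. in_hu P t}"
  shows "finite (ground_CS P A)"
proof -
  let ?xs = "sorted_list_of_set (vars_atm A)"
  have inst: "finite ((\<lambda>\<gamma>. map \<gamma> ?xs) ` {\<gamma>. grounding P \<gamma>})"
  proof (rule finite_subset)
    show "(\<lambda>\<gamma>. map \<gamma> ?xs) ` {\<gamma>. grounding P \<gamma>} \<subseteq> {ts. set ts \<subseteq> {t. in_hu P t} \<and> length ts = length ?xs}"
      by (auto simp: grounding_def)
  qed (rule finite_lists_length_eq[OF assms(2)])
  let ?f = "\<lambda>ts. {(K, subst_of (zip ?xs ts)) | K. ground_counter_support P (subst_atm (subst_of (zip ?xs ts)) A) K}"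
  have "finite (?f ts)" for ts
  proof -
    let ?B = "subst_atm (subst_of (zip ?xs ts)) A"
    have "finite {K. ground_counter_support P ?B K}"
    proof (cases "in_hb P ?B")
      case True
      \<comment> \<open>By \<open>finite_ground_counter_support\<close>, each counter-support is a
        subset of the atoms on which the instance depends.\<close>
      then have "finite (Pow {C. depends P ?B C})" using assms(1) by (simp add: finitely_recursive_def)
      then show ?thesis
        by (rule finite_subset[rotated]) (use finite_ground_counter_support(1)[OF assms(1)] in blast)
    next
      case False
      then show ?thesis by (simp add: ground_counter_support_not_in_hb)
    qed
    then show ?thesis by simp
  qed
  then have "finite (\<Union>ts\<in>(\<lambda>\<gamma>. map \<gamma> ?xs) ` {\<gamma>. grounding P \<gamma>}. ?f ts)" using inst by blast
  moreover have "ground_CS P A \<subseteq> (\<Union>ts\<in>(\<lambda>\<gamma>. map \<gamma> ?xs) ` {\<gamma>. grounding P \<gamma>}. ?f ts)"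
  proof
    fix Kt
    assume "Kt \<in> ground_CS P A"
    then obtain \<gamma> K where Kt: "Kt = (K, ground_subst A \<gamma>)" "grounding P \<gamma>"
      "ground_counter_support P (subst_atm \<gamma> A) K" by (auto simp: ground_CS_def)
    have "subst_of (zip ?xs (map \<gamma> ?xs)) = ground_subst A \<gamma>"
      by (simp add: ground_subst_def zip_map2 zip_same_conv_map comp_def)
    then have "Kt \<in> ?f (map \<gamma> ?xs)" using Kt(1,3) by (simp add: subst_ground_subst)
    then show "Kt \<in> (\<Union>ts\<in>(\<lambda>\<gamma>. map \<gamma> ?xs) ` {\<gamma>. grounding P \<gamma>}. ?f ts)" using Kt(2) by blast
  qed
  ultimately show ?thesis by (rule finite_subset[rotated])
qed

lemma re_cs_set_ground_CS:
  assumes "finite P" and "finitely_recursive P"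
  shows "re_cs_set (ground_CS P A)"
proof (cases "finite {t. in_hu P t}")
  case True
  have "\<exists>ks bs. Kt = (set ks, subst_of bs)" if mem: "Kt \<in> ground_CS P A" for Kt
  proof -
    obtain \<gamma> K where Kt: "Kt = (K, ground_subst A \<gamma>)" "ground_counter_support P (subst_atm \<gamma> A) K"
      using mem by (auto simp: ground_CS_def)
    then obtain ks where "set ks = K"
      using finite_list finite_ground_counter_support(2)[OF assms(2)] by blast
    then show ?thesis using Kt(1) unfolding ground_subst_def by blast
  qed
  then show ?thesis by (rule re_cs_set_finite[OF finite_ground_CS[OF assms(2) True]])
next
  case False
  then have safe: "safe P" by (rule finitely_recursive_safe[OF assms(2)])
  show ?thesis
  proof (cases "syms_atm A \<subseteq> lang P")
    case True
    define Q where "Q = (\<lambda>a l. (\<exists>N. finite N \<and> dec_atm a \<in> N \<and>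
        blocked (instances P) (dec_atm ` set (list_decode l)) N) \<and>
      (\<forall>B\<in>dec_atm ` set (list_decode l). \<exists>S. goal_support (instances P) [Pos (dec_atm a)] S \<and> B \<in> S))"
    have Q: "re (\<lambda>z. Q (fst (prod_decode z)) (snd (prod_decode z)))"
      unfolding Q_def by (rule re_ground_counter_support[OF assms safe])
    show ?thesis
    proof (rule re_cs_set_ground_CSI[OF assms])
      show "re (\<lambda>z. Q (enc_atm (subst_atm (dec_subst (fst (prod_decode z))) A)) (snd (prod_decode z)))"
        by (intro re_compose2[OF Q] computable_enc_subst_atm computable_intros)
      show "Q (enc_atm (subst_atm (dec_subst s) A)) (list_encode (map enc_atm ks)) \<longleftrightarrow>
          ground_counter_support P (subst_atm (dec_subst s) A) (set ks)"
        if "\<forall>x\<in>vars_atm A. in_hu P (dec_subst s x)" for s ks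
      proof -
        have "in_hb P (subst_atm (dec_subst s) A)" using True that by (simp add: in_hb_subst)
        moreover have "dec_atm ` set (list_decode (list_encode (map enc_atm ks))) = set ks"
          by (simp add: image_image)
        ultimately show ?thesis
          unfolding Q_def by (simp only: ground_counter_support_instances[OF safe assms(2)] dec_enc_atm)
      qed
    qed
  next
    case False
    then have "\<not> in_hb P (subst_atm \<gamma> A)" for \<gamma> by (simp add: in_hb_subst)
    \<comment> \<open>With a symbol foreign to the program, \<open>A\<close> has no instance in the
      Herbrand base, so only the empty set is a counter-support, and 0 is the code of the empty
      list.\<close>
    then have "ground_counter_support P (subst_atm \<gamma> A) (set ks) \<longleftrightarrow> list_encode (map enc_atm ks) = 0" for \<gamma> ks
      by (cases ks) (simp_all add: ground_counter_support_not_in_hb)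
    then show ?thesis
      by (intro re_cs_set_ground_CSI[OF assms, of "\<lambda>s l. l = 0"] re_eq computable_intros) simp
  qed
qed

theorem theorem6p10:
  fixes P :: "rule set"
  assumes "finite P" and "finitely_recursive P"
  shows "\<exists>CS. is_CounterSupp P CS \<and> complete_CounterSupp P CS \<and> (\<forall>A. re_cs_set (CS A))"
  using is_CounterSupp_ground_CS[OF assms(2)] complete_CounterSupp_ground_CS
    re_cs_set_ground_CS[OF assms] by blast

end
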